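(* Let $n\ge 1$ be an integer and let $T\subseteq\{1,\ldots,\lfloor n/2\rfloor\}$ be a nonempty set such that $t'(n-t')$ is even for every $t'\in T$. Let $\mathcal{F}_T=\{K_{t',n-t'}: t'\in T\}$ and $t=\max T$. (a) If $T$ contains only odd integers, then $r_{odd}(n,\mathcal{F}_T)=t+2$. (b) Suppose $T$ contains an even integer, and let $2d$ be the largest even integer in $T$. (b1) There is a constant $C_d$ depending only on $d$ (and not on $n$ or $T$) such that \[ d\log n - C_d \le r_{odd}(n,\mathcal{F}_T)\le d\log n + d + t + 2. \] (b2) Suppose $T=\{2d\}$. If $n=4d$, then $r_{odd}(n,\mathcal{F}_T)=2d+1$. If $n>4d$, then $2d+2\le r_{odd}(n,\mathcal{F}_T)\le n-2d+1$.
   Context: All logarithms are to base $2$. $K_n$ is the complete graph on vertex set $[n]=\{1,\ldots,n\}$, and $K_{a,b}$ is the complete bipartite graph with parts of sizes $a$ and $b$. A copy of a graph $H$ in $K_n$ is a (not necessarily induced) subgraph of $K_n$ isomorphic to $H$. For a positive integer $r$, an $r$-colouring $G_1,\ldots,G_r$ of $K_n$ is a partition of the edge set of $K_n$ into $r$ (possibly empty) colour classes. A copy of $H$ has an odd colour class if it contains an odd number of edges of $G_i$ for some $i$. For a family $\mathcal{H}$ of graphs, the odd-Ramsey number $r_{odd}(n,\mathcal{H})$ is the minimum positive integer $r$ for which there exists an $r$-colouring of $K_n$ such that every copy in $K_n$ of every graph $H\in\mathcal{H}$ has an odd colour class. *)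

theory Defs
  imports Complex_Main "HOL-Library.Ramsey" "HOL-Library.Disjoint_Sets"
begin

(* A graph is a pair (vertices, edges); an edge is a two-element set of vertices.
   nsets V 2 is the set of all two-element subsets of V. *)
type_synonym 'v graph = "'v set \<times> 'v set set"

abbreviation verts :: "'v graph \<Rightarrow> 'v set" where "verts \<equiv> fst"
abbreviation edges :: "'v graph \<Rightarrow> 'v set set" where "edges \<equiv> snd"

definition simple_graph :: "'v graph \<Rightarrow> bool" where
  "simple_graph G \<longleftrightarrow> edges G \<subseteq> nsets (verts G) 2"

definition subgraph :: "'v graph \<Rightarrow> 'v graph \<Rightarrow> bool" where
  "subgraph H G \<longleftrightarrow> simple_graph H \<and> verts H \<subseteq> verts G \<and> edges H \<subseteq> edges G"

definition isomorphic :: "'v graph \<Rightarrow> 'w graph \<Rightarrow> bool" where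
  "isomorphic G H \<longleftrightarrow> (\<exists>f. bij_betw f (verts G) (verts H) \<and>
     (\<forall>u\<in>verts G. \<forall>v\<in>verts G. {u, v} \<in> edges G \<longleftrightarrow> {f u, f v} \<in> edges H))"

definition complete_graph :: "nat \<Rightarrow> nat graph" where
  "complete_graph n = ({1..n}, nsets {1..n} 2)"

definition complete_bipartite :: "nat \<Rightarrow> nat \<Rightarrow> nat graph" where
  "complete_bipartite a b = ({1..a + b}, {{u, v} | u v. u \<in> {1..a} \<and> v \<in> {a + 1..a + b}})"

definition is_copy :: "nat \<Rightarrow> nat graph \<Rightarrow> nat graph \<Rightarrow> bool" where
  "is_copy n H G \<longleftrightarrow> subgraph G (complete_graph n) \<and> isomorphic G H"

(* The colour classes are c 1, ..., c r; some of them may be empty. *)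
definition colouring :: "nat \<Rightarrow> nat \<Rightarrow> (nat \<Rightarrow> nat set set) \<Rightarrow> bool" where
  "colouring n r c \<longleftrightarrow>
     disjoint_family_on c {1..r} \<and> (\<Union>i\<in>{1..r}. c i) = edges (complete_graph n)"

definition has_odd_colour_class :: "nat \<Rightarrow> (nat \<Rightarrow> nat set set) \<Rightarrow> nat graph \<Rightarrow> bool" where
  "has_odd_colour_class r c G \<longleftrightarrow> (\<exists>i\<in>{1..r}. odd (card (edges G \<inter> c i)))"

(* The minimum exists whenever every member of the family has an edge, since
   one may give every edge of the complete graph its own colour. *)
definition r_odd :: "nat \<Rightarrow> nat graph set \<Rightarrow> nat" where
  "r_odd n \<H> = (LEAST r. r \<ge> 1 \<and> (\<exists>c. colouring n r c \<and>
     (\<forall>H\<in>\<H>. \<forall>G. is_copy n H G \<longrightarrow> has_odd_colour_class r c G)))"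

definition admissible :: "nat \<Rightarrow> nat set \<Rightarrow> bool" where
  "admissible n T \<longleftrightarrow>
     n \<ge> 1 \<and> T \<subseteq> {1..n div 2} \<and> T \<noteq> {} \<and> (\<forall>s\<in>T. even (s * (n - s)))"

definition bipartite_family :: "nat \<Rightarrow> nat set \<Rightarrow> nat graph set" where
  "bipartite_family n T = (\<lambda>s. complete_bipartite s (n - s)) ` T"

end

theory Submission
  imports Defs "HOL-Library.Function_Algebras" "HOL-Library.Z2" "HOL-Analysis.L2_Norm"
    "HOL-Algebra.Algebraic_Closure_Type"
begin

text \<open>
  Copies of \<open>K\<^bsub>s,n-s\<^esub>\<close> are the cuts of vertex sets \<open>S\<close> of size \<open>s\<close>, and the parity of a colour class in a
  cut is the sum over \<open>S\<close> of its degree parities. Hence \<open>r\<close> colours suffice iff there are \<open>n\<close> vectors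
  over the field with two elements, of dimension \<open>r - 1\<close>, which sum to zero and such that no subfamily of
  size in \<open>T\<close> sums to zero.

  For the exact lower bounds, take disjoint pairs of vectors whose differences are independent, as many
  as possible. If the dimension is too small, all vectors lie in a single coset of the span of
  these differences, and a suitable choice of one vector per pair together with unpaired vectors has sum
  zero. For the logarithmic lower bound, let \<open>E\<^sub>m\<close> be the number of zero-sum \<open>2m\<close>-tuples. It is
  log-convex in \<open>m\<close> by Cauchy-Schwarz and \<open>E\<^sub>0 = 1\<close>; if every zero-sum \<open>2d\<close>-tuple has a repeated entry, then
  \<open>E\<^sub>d \<le> 4 d\<^sup>2 n E\<^bsub>d-1\<^esub>\<close>, so \<open>E\<^sub>d = O(n\<^sup>d)\<close>, whereas \<open>E\<^sub>d\<close> is at least \<open>n\<^bsup>2d\<^esup>\<close> divided by the number of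
  vectors in the space.

  The upper bounds use a basis together with its sum, respectively the columns of the parity check
  matrix of a BCH code.
\<close>

section \<open>Zero-sum subsets in elementary abelian 2-groups\<close>

text \<open>Such a group is a vector space over the field with two elements, with subset sums as
  linear combinations. The class covers both function spaces used later, with values in
  \<open>bit\<close> and in \<open>bit alg_closure\<close>.\<close>

class elementary_2_group = ab_group_add +
  assumes add_self [simp]: "x + x = 0"
begin

lemma add_self_left [simp]: "x + (x + y) = y"
  by (simp flip: add.assoc)

lemma add_eq_0_iff_eq: "x + y = 0 \<longleftrightarrow> x = y"
  by (metis add_self add_self_left add_0_right)

lemma sum_const_parity: "finite S \<Longrightarrow> (\<Sum>v\<in>S. a) = (if even (card S) then 0 else a)"
  by (induction S rule: finite_induct) auto

lemma sum_const_even: "even (card S) \<Longrightarrow> (\<Sum>v\<in>S. a) = 0"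
  by (cases "finite S") (simp_all add: sum_const_parity)

lemma sum_const_odd: "odd (card S) \<Longrightarrow> (\<Sum>v\<in>S. a) = a"
  by (cases "finite S") (simp_all add: sum_const_parity)

lemma sum_sym_diff:
  assumes "finite I" "finite J"
  shows "sum Y I + sum Y J = sum Y (sym_diff I J)"
proof -
  have 1: "sum Y I = sum Y (I - J) + sum Y (I \<inter> J)"
    using assms by (metis sum.Int_Diff add.commute)
  have 2: "sum Y J = sum Y (J - I) + sum Y (I \<inter> J)"
    using assms by (metis sum.Int_Diff add.commute Int_commute)
  have "sum Y (sym_diff I J) = sum Y (I - J) + sum Y (J - I)"
    using assms by (intro sum.union_disjoint) auto
  then show ?thesis unfolding 1 2
    by (simp add: ac_simps)
qed

section \<open>Subgroups, spans and independent families\<close>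

definition subgroup2 :: "'a set \<Rightarrow> bool" where
  "subgroup2 A \<longleftrightarrow> 0 \<in> A \<and> (\<forall>x\<in>A. \<forall>y\<in>A. x + y \<in> A)"

lemma subgroup2_add: "subgroup2 A \<Longrightarrow> x \<in> A \<Longrightarrow> y \<in> A \<Longrightarrow> x + y \<in> A"
  by (simp add: subgroup2_def)

lemma subgroup2_sum: "subgroup2 A \<Longrightarrow> (\<And>i. i \<in> I \<Longrightarrow> Y i \<in> A) \<Longrightarrow> sum Y I \<in> A"
  by (induction I rule: infinite_finite_induct) (auto simp: subgroup2_def)

text \<open>The linear span of the family, since the only coefficients are 0 and 1.\<close>

definition subset_sums :: "('i \<Rightarrow> 'a) \<Rightarrow> 'i set \<Rightarrow> 'a set" where
  "subset_sums Y I = sum Y ` Pow I"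

text \<open>Linear independence of an indexed family: equal vectors at two different indices count
  as a dependency.\<close>

definition independent_on :: "('i \<Rightarrow> 'a) \<Rightarrow> 'i set \<Rightarrow> bool" where
  "independent_on Y I \<longleftrightarrow> (\<forall>J\<subseteq>I. sum Y J = 0 \<longrightarrow> J = {})"

lemma subgroup2_subset_sums:
  assumes "finite I" shows "subgroup2 (subset_sums Y I)"
  unfolding subgroup2_def
proof (intro conjI ballI)
  show "0 \<in> subset_sums Y I" unfolding subset_sums_def by (rule image_eqI[of _ _ "{}"]) auto
  fix x y assume "x \<in> subset_sums Y I" "y \<in> subset_sums Y I"
  then obtain J K where "J \<subseteq> I" "K \<subseteq> I" "x = sum Y J" "y = sum Y K"
    by (auto simp: subset_sums_def)
  moreover from this have "x + y = sum Y (sym_diff J K)"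
    using assms by (simp add: sum_sym_diff finite_subset)
  moreover have "sym_diff J K \<in> Pow I" using \<open>J \<subseteq> I\<close> \<open>K \<subseteq> I\<close> by auto
  ultimately show "x + y \<in> subset_sums Y I" unfolding subset_sums_def by blast
qed

lemma subset_sums_self: "i \<in> I \<Longrightarrow> Y i \<in> subset_sums Y I"
  unfolding subset_sums_def by (rule image_eqI[of _ _ "{i}"]) auto

lemma subset_sums_mono: "I \<subseteq> J \<Longrightarrow> subset_sums Y I \<subseteq> subset_sums Y J"
  by (auto simp: subset_sums_def)

lemma subset_sums_subset: "subgroup2 A \<Longrightarrow> (\<And>i. i \<in> I \<Longrightarrow> Y i \<in> A) \<Longrightarrow> subset_sums Y I \<subseteq> A"
  unfolding subset_sums_def by (auto intro!: subgroup2_sum)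

lemma card_subset_sums_le: "finite I \<Longrightarrow> card (subset_sums Y I) \<le> 2 ^ card I"
  unfolding subset_sums_def by (metis card_Pow card_image_le finite_Pow_iff)

lemma independent_on_subset: "independent_on Y I \<Longrightarrow> J \<subseteq> I \<Longrightarrow> independent_on Y J"
  by (auto simp: independent_on_def)

lemma independent_on_inj_sum:
  assumes "finite I" "independent_on Y I"
  shows "inj_on (sum Y) (Pow I)"
proof (rule inj_onI)
  fix J K assume JK: "J \<in> Pow I" "K \<in> Pow I" "sum Y J = sum Y K"
  then have "sum Y (sym_diff J K) = 0"
    using assms(1) by (metis PowD add_self finite_subset sum_sym_diff)
  with JK assms(2) have "sym_diff J K = {}"
    unfolding independent_on_def by (metis PowD Diff_subset Un_least subset_trans)
  then show "J = K" by auto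
qed

lemma card_subset_sums:
  "finite I \<Longrightarrow> independent_on Y I \<Longrightarrow> card (subset_sums Y I) = 2 ^ card I"
  by (simp add: subset_sums_def card_image independent_on_inj_sum card_Pow)

text \<open>The dimension bound in counting form: an independent family of size \<open>m\<close> has
  \<open>2 ^ m\<close> different subset sums, all of them in \<open>A\<close>.\<close>

lemma card_independent_le:
  assumes "finite I" "independent_on Y I" "subgroup2 A" "finite A" "card A \<le> 2 ^ k"
    "\<And>i. i \<in> I \<Longrightarrow> Y i \<in> A"
  shows "card I \<le> k"
proof -
  have "2 ^ card I \<le> card A"
    using card_mono[OF assms(4) subset_sums_subset[of A I Y, OF assms(3,6)]]
    by (simp add: card_subset_sums assms(1,2))
  with assms(5) have "(2::nat) ^ card I \<le> 2 ^ k" by linarith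
  then show ?thesis by simp
qed

lemma independent_on_insert:
  assumes "finite I" "independent_on Y I" "i \<notin> I" "Y i \<notin> subset_sums Y I"
  shows "independent_on Y (insert i I)"
  unfolding independent_on_def
proof (intro allI impI)
  fix J assume J: "J \<subseteq> insert i I" "sum Y J = 0"
  have "i \<notin> J"
  proof
    assume "i \<in> J"
    have "finite J" using J assms(1) by (meson finite_insert finite_subset)
    with \<open>i \<in> J\<close> J(2) have "Y i = sum Y (J - {i})"
      by (simp add: sum.remove add_eq_0_iff_eq)
    with J(1) assms(4) show False unfolding subset_sums_def by blast
  qed
  with J assms(2) show "J = {}" unfolding independent_on_def by blast
qed

lemma subset_sums_insert:
  assumes "finite I" "x \<in> subset_sums Y (insert i I)"
  shows "x \<in> subset_sums Y I \<or> x + Y i \<in> subset_sums Y I"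
proof -
  from assms obtain J where J: "J \<subseteq> insert i I" "x = sum Y J" by (auto simp: subset_sums_def)
  have fin: "finite J" using J assms(1) by (meson finite_insert finite_subset)
  show ?thesis
  proof (cases "i \<in> J")
    case True
    then have "x + Y i = sum Y (J - {i})" using J(2) fin by (simp add: sum.remove ac_simps)
    moreover have "J - {i} \<subseteq> I" using J(1) by auto
    ultimately show ?thesis by (auto simp: subset_sums_def)
  next
    case False
    with J show ?thesis by (auto simp: subset_sums_def)
  qed
qed

text \<open>An independent subset of maximum size works, because a vector outside its span could be
  added to it.\<close>

lemma maximal_independent_subset:
  assumes "finite I"
  obtains B where "B \<subseteq> I" "independent_on Y B" "\<And>i. i \<in> I \<Longrightarrow> Y i \<in> subset_sums Y B"
proof -
  let ?P = "\<lambda>B. B \<subseteq> I \<and> independent_on Y B"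
  have "?P {}" by (auto simp: independent_on_def)
  moreover have "\<forall>B. ?P B \<longrightarrow> card B < Suc (card I)" using assms by (auto simp: less_Suc_eq_le intro: card_mono)
  ultimately have "\<exists>B. ?P B \<and> (\<forall>C. ?P C \<longrightarrow> card C \<le> card B)"
    by (rule ex_has_greatest_nat[of ?P "{}" card "Suc (card I)"])
  then obtain B where B: "?P B" "\<And>C. ?P C \<Longrightarrow> card C \<le> card B" by blast
  have "Y i \<in> subset_sums Y B" if "i \<in> I" for i
  proof (cases "i \<in> B")
    case False
    have fin: "finite B" using B(1) assms by (blast intro: finite_subset)
    then have "\<not> card (insert i B) \<le> card B" using False by simp
    with B(2)[of "insert i B"] independent_on_insert[OF fin _ False, of Y] B(1) that show ?thesis by blast
  qed (simp add: subset_sums_self)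
  with B(1) that show ?thesis by blast
qed

end

section \<open>Pairings with independent differences\<close>

definition pairing :: "'v set \<Rightarrow> ('v \<times> 'v) set \<Rightarrow> bool" where
  "pairing V M \<longleftrightarrow> fst ` M \<union> snd ` M \<subseteq> V \<and> inj_on fst M \<and> inj_on snd M \<and> fst ` M \<inter> snd ` M = {}"

text \<open>In characteristic two differences are sums. Replacing one element of a pair by the other
  changes a sum by this vector.\<close>

definition difference :: "('v \<Rightarrow> 'a::elementary_2_group) \<Rightarrow> 'v \<times> 'v \<Rightarrow> 'a" where
  "difference Y p = Y (fst p) + Y (snd p)"

lemma difference_pair: "difference Y (v, w) = Y v + Y w"
  by (simp add: difference_def)

lemma maximal_pairing:
  fixes Y :: "'v \<Rightarrow> 'a::elementary_2_group"
  assumes "finite V"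
  obtains M where "pairing V M" "independent_on (difference Y) M"
    "\<And>N. pairing V N \<Longrightarrow> independent_on (difference Y) N \<Longrightarrow> card N \<le> card M"
proof -
  let ?P = "\<lambda>M. pairing V M \<and> independent_on (difference Y) M"
  have "?P {}" by (auto simp: independent_on_def pairing_def)
  moreover have "\<forall>M. ?P M \<longrightarrow> card M < Suc (card (V \<times> V))"
    unfolding less_Suc_eq_le
  proof (intro allI impI card_mono)
    fix M assume "?P M"
    then have "fst ` M \<subseteq> V" "snd ` M \<subseteq> V" by (simp_all add: pairing_def)
    then show "M \<subseteq> V \<times> V" by (auto simp: image_subset_iff)
  qed (simp add: assms)
  ultimately have "\<exists>M. ?P M \<and> (\<forall>N. ?P N \<longrightarrow> card N \<le> card M)"
    by (rule ex_has_greatest_nat[of ?P "{}" card "Suc (card (V \<times> V))"])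
  then obtain M where "?P M" "\<And>N. ?P N \<Longrightarrow> card N \<le> card M" by blast
  with that show ?thesis by blast
qed

lemma pairing_insert:
  assumes "pairing V M" "x \<in> V" "y \<in> V" "x \<noteq> y" "x \<notin> fst ` M \<union> snd ` M" "y \<notin> fst ` M \<union> snd ` M"
  shows "pairing V (insert (x, y) M)"
  using assms by (auto simp: pairing_def inj_on_insert)

lemma pairing_finite: "pairing V M \<Longrightarrow> finite V \<Longrightarrow> finite M"
  unfolding pairing_def by (meson finite_imageD finite_subset le_sup_iff)

lemma card_unpaired:
  assumes "pairing V M" "finite V"
  shows "card (V - (fst ` M \<union> snd ` M)) = card V - 2 * card M"
proof -
  have "finite M" using assms by (rule pairing_finite)
  then have "card (fst ` M \<union> snd ` M) = card M + card M"
    using assms by (simp add: pairing_def card_Un_disjoint card_image)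
  with \<open>finite M\<close> assms show ?thesis
    by (subst card_Diff_subset) (auto simp: pairing_def)
qed

text \<open>Once their pair is removed, both elements are free to enter new pairs; this prepares the
  exchange argument.\<close>

lemma pairing_vertices:
  assumes "pairing V M" "(g, g') \<in> M"
  shows "g \<in> V" "g' \<in> V" "g \<noteq> g'"
    "g \<notin> fst ` (M - {(g, g')})" "g \<notin> snd ` (M - {(g, g')})"
    "g' \<notin> fst ` (M - {(g, g')})" "g' \<notin> snd ` (M - {(g, g')})"
proof -
  have 1: "g \<in> fst ` M" "g' \<in> snd ` M" using assms(2) by force+
  have 2: "fst ` M \<union> snd ` M \<subseteq> V" "inj_on fst M" "inj_on snd M" "fst ` M \<inter> snd ` M = {}"
    using assms(1) by (simp_all add: pairing_def)
  show "g \<in> V" "g' \<in> V" "g \<noteq> g'" using 1 2 by blast+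
  show "g \<notin> fst ` (M - {(g, g')})" using inj_onD[OF 2(2) _ assms(2)] by force
  show "g' \<notin> snd ` (M - {(g, g')})" using inj_onD[OF 2(3) _ assms(2)] by force
  show "g \<notin> snd ` (M - {(g, g')})" "g' \<notin> fst ` (M - {(g, g')})" using 1 2(4) by blast+
qed

text \<open>Choosing one element from each pair and further unpaired elements gives a sum in the span \<open>U\<close> of
  the differences; switching to the other element in suitable pairs makes it zero.\<close>

lemma zero_sum_subset_of_pairing:
  fixes Y :: "'v \<Rightarrow> 'a::elementary_2_group"
  assumes fin: "finite V" and M: "pairing V M"
    and coset: "\<And>v. v \<in> V \<Longrightarrow> Y v + a \<in> subset_sums (difference Y) M"
    and t: "card M \<le> t" "t + card M \<le> card V"
    and par: "even t \<or> odd (card V) \<and> sum Y V = 0"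
  obtains S where "S \<subseteq> V" "card S = t" "sum Y S = 0"
proof -
  let ?R = "V - (fst ` M \<union> snd ` M)" and ?U = "subset_sums (difference Y) M"
  have finM: "finite M" using M fin by (rule pairing_finite)
  have U: "subgroup2 ?U" using finM by (rule subgroup2_subset_sums)
  have "t - card M \<le> card ?R" using t card_unpaired[OF M fin] by linarith
  then obtain E where E: "E \<subseteq> ?R" "card E = t - card M" "finite E"
    using obtain_subset_with_card_n[of "t - card M" ?R] by blast
  let ?S = "fst ` M \<union> E"
  have S: "?S \<subseteq> V" using M E by (auto simp: pairing_def)
  have "fst ` M \<inter> E = {}" using E by blast
  then have cardS: "card ?S = t"
    using M E t finM by (simp add: pairing_def card_Un_disjoint card_image)
  have finS: "finite ?S" using E finM by simp
  have shift: "sum Y W + (\<Sum>v\<in>W. a) \<in> ?U" if "W \<subseteq> V" for W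
    unfolding sum.distrib[symmetric] using that coset by (intro subgroup2_sum[OF U]) auto
  \<comment> \<open>For even \<open>t\<close> the translates cancel. For odd \<open>t\<close>,
    \<open>shift\<close> applied to all of \<open>V\<close>, which has odd size and sum zero, shows
    that \<open>a\<close> itself lies in the span.\<close>
  have "(\<Sum>v\<in>?S. a) \<in> ?U"
  proof (cases "even t")
    case True
    then show ?thesis using U cardS by (simp add: sum_const_even subgroup2_def)
  next
    case False
    then show ?thesis using par cardS shift[of V] by (simp add: sum_const_odd)
  qed
  from subgroup2_add[OF U this shift[OF S]] have "sum Y ?S \<in> ?U"
    by (simp add: add.left_commute)
  then obtain J where J: "J \<subseteq> M" "sum Y ?S = sum (difference Y) J"
    by (auto simp: subset_sums_def)
  have finJ: "finite J" using J(1) finM by (rule finite_subset)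
  let ?S' = "fst ` (M - J) \<union> snd ` J \<union> E"
  have inj: "inj_on fst M" "inj_on snd M" "fst ` M \<inter> snd ` M = {}" using M by (auto simp: pairing_def)
  have injJ: "inj_on fst (M - J)" "inj_on fst J" "inj_on snd J"
    using inj J by (auto intro: inj_on_subset)
  have disj: "fst ` (M - J) \<inter> snd ` J = {}" "(fst ` (M - J) \<union> snd ` J) \<inter> E = {}" "fst ` M \<inter> E = {}"
    using inj J E by fast+
  have "card ?S' = card (M - J) + card J + card E"
    using disj finM finJ E injJ by (simp add: card_Un_disjoint card_image)
  also have "\<dots> = t" using card_mono[OF finM J(1)] finJ J(1) E t by (simp add: card_Diff_subset)
  finally have "card ?S' = t" .
  moreover have "sum Y ?S' = 0"
  proof -
    have "sum Y ?S = sum (Y \<circ> fst) (M - J) + sum (Y \<circ> fst) J + sum Y E"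
      using disj finM E inj sum.subset_diff[OF J(1) finM, of "Y \<circ> fst"]
      by (simp add: sum.union_disjoint sum.reindex)
    moreover have "sum Y ?S' = sum (Y \<circ> fst) (M - J) + sum (Y \<circ> snd) J + sum Y E"
      using disj finM finJ E injJ by (simp add: sum.union_disjoint sum.reindex)
    moreover have "sum (difference Y) J = sum (Y \<circ> fst) J + sum (Y \<circ> snd) J"
      by (simp add: difference_def sum.distrib)
    ultimately have "sum Y ?S' = sum Y ?S + sum (difference Y) J"
      by (simp add: ac_simps)
    with J(2) show ?thesis by simp
  qed
  moreover have "?S' \<subseteq> V" using M J(1) E unfolding pairing_def by blast
  ultimately show ?thesis using that by blast
qed

text \<open>If a paired element \<open>g\<close> were outside the coset \<open>a + U\<close> containing the unpaired elements, then
  replacing its pair \<open>(g, g')\<close> by \<open>(g, v)\<close> and \<open>(g', w)\<close> would increase the rank, unless \<open>Y v + Y w\<close>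
  lies outside the span of the other differences, which has index 2 in \<open>U\<close>. This cannot happen for
  all three pairs formed from three unpaired elements.\<close>

lemma maximal_pairing_coset:
  fixes Y :: "'v \<Rightarrow> 'a::elementary_2_group"
  assumes fin: "finite V" and M: "pairing V M" "independent_on (difference Y) M"
    and maxM: "\<And>N. pairing V N \<Longrightarrow> independent_on (difference Y) N \<Longrightarrow> card N \<le> card M"
    and large: "2 * card M + 3 \<le> card V"
  obtains a where "\<And>v. v \<in> V \<Longrightarrow> Y v + a \<in> subset_sums (difference Y) M"
proof -
  let ?R = "V - (fst ` M \<union> snd ` M)" and ?U = "subset_sums (difference Y)"
  have finM: "finite M" using M(1) fin by (rule pairing_finite)
  have U: "subgroup2 (?U N)" if "N \<subseteq> M" for N using finM that by (auto intro: subgroup2_subset_sums finite_subset)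
  have addM: "a + b \<in> ?U M" if "a \<in> ?U M" "b \<in> ?U M" for a b
    using U[of M] that by (simp add: subgroup2_def)
  have "3 \<le> card ?R" using large card_unpaired[OF M(1) fin] by linarith
  then obtain Q where Q: "Q \<subseteq> ?R" "card Q = 3" "finite Q"
    by (rule obtain_subset_with_card_n)
  then obtain x y z where "Q = {x, y, z}" and neq: "x \<noteq> y" "x \<noteq> z" "y \<noteq> z"
    by (metis card_3_iff)
  with Q(1) have xyz: "{x, y, z} \<subseteq> ?R" "x \<noteq> y" "x \<noteq> z" "y \<noteq> z" by simp_all
  \<comment> \<open>By maximality the pair \<open>(v, w)\<close> cannot be added to
    \<open>M\<close>.\<close>
  have RU: "Y v + Y w \<in> ?U M" if "v \<in> ?R" "w \<in> ?R" for v w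
  proof (cases "v = w")
    case True
    then show ?thesis using U[of M] by (simp add: subgroup2_def)
  next
    case False
    have new: "(v, w) \<notin> M" using that by force
    have "pairing V (insert (v, w) M)" using that M False by (intro pairing_insert) auto
    from maxM[OF this] new finM have "\<not> independent_on (difference Y) (insert (v, w) M)" by auto
    with independent_on_insert[OF finM M(2) new] show ?thesis by (auto simp: difference_def)
  qed
  have pair: "Y g + Y x \<in> ?U M" if p: "(g, g') \<in> M" for g g'
  proof (rule ccontr)
    assume gx: "Y g + Y x \<notin> ?U M"
    let ?N = "M - {(g, g')}"
    have Minsert: "M = insert (g, g') ?N" using p by auto
    have finN: "finite ?N" using finM by simp
    have indN: "independent_on (difference Y) ?N" using M(2) by (rule independent_on_subset) auto
    have pN: "Y g + Y g' \<notin> ?U ?N"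
    proof
      assume "Y g + Y g' \<in> ?U ?N"
      then obtain J where J: "J \<subseteq> ?N" "Y g + Y g' = sum (difference Y) J"
        by (auto simp: subset_sums_def)
      have "finite J" using J(1) finN finite_subset by blast
      moreover have "(g, g') \<notin> J" using J by auto
      ultimately have "sum (difference Y) (insert (g, g') J) = 0"
        using J by (simp flip: J(2) add: difference_def)
      then show False using M(2) J p unfolding independent_on_def by blast
    qed
    have addN: "a + b \<in> ?U ?N" if "a \<in> ?U ?N" "b \<in> ?U ?N" for a b
      using U[of ?N] that by (simp add: subgroup2_def)
    note gfresh = pairing_vertices[OF M(1) p]
    have pairN: "pairing V ?N" using M(1) by (auto simp: pairing_def inj_on_def)
    have exchange: "v = w" if "v \<in> ?R" "w \<in> ?R" and vw: "Y v + Y w \<in> ?U ?N" for v w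
    proof (rule ccontr)
      assume "v \<noteq> w"
      have "g \<in> fst ` M" "g' \<in> snd ` M" using p by force+
      then have rfresh: "v \<notin> fst ` ?N \<union> snd ` ?N" "w \<notin> fst ` ?N \<union> snd ` ?N"
        "v \<noteq> g" "v \<noteq> g'" "w \<noteq> g" "w \<noteq> g'"
        using that(1,2) by blast+
      have fresh: "(g, v) \<notin> ?N" "(g', w) \<notin> insert (g, v) ?N" using gfresh by force+
      have gv: "Y g + Y v \<notin> ?U M"
      proof
        assume "Y g + Y v \<in> ?U M"
        then have "(Y g + Y v) + (Y v + Y x) \<in> ?U M"
          by (rule addM) (use RU[of v x] that xyz in auto)
        with gx show False by (simp add: add.assoc)
      qed
      have NM: "?U ?N \<subseteq> ?U M" by (intro subset_sums_mono) auto
      have 1: "independent_on (difference Y) (insert (g, v) ?N)"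
        using fresh(1) gv NM by (intro independent_on_insert finN indN) (auto simp: difference_def)
      \<comment> \<open>Modulo the span of \<open>?N\<close> the vectors of \<open>v\<close> and
        \<open>w\<close> agree. A dependency not involving \<open>(g, v)\<close> would put
        \<open>Y g + Y v\<close> into the span of \<open>M\<close>; one involving it would put
        \<open>Y g + Y g'\<close> into the span of \<open>?N\<close>.\<close>
      have 2: "Y g' + Y w \<notin> ?U (insert (g, v) ?N)"
      proof
        assume "Y g' + Y w \<in> ?U (insert (g, v) ?N)"
        from subset_sums_insert[OF finN this] consider
          "Y g' + Y w \<in> ?U ?N" | "Y g' + Y w + (Y g + Y v) \<in> ?U ?N" by (auto simp: difference_def)
        then show False
        proof cases
          case 1
          have "(Y g' + Y w) + (Y v + Y w) \<in> ?U M"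
            by (rule addM) (use 1 vw NM in auto)
          moreover have "Y g' + Y g \<in> ?U M" using subset_sums_self[OF p, of "difference Y"] by (simp add: difference_def add.commute)
          ultimately have "((Y g' + Y w) + (Y v + Y w)) + (Y g' + Y g) \<in> ?U M"
            by (rule addM)
          then have "Y g + Y v \<in> ?U M" by (simp add: ac_simps)
          with gv show False by simp
        next
          case 2
          then have "(Y g' + Y w + (Y g + Y v)) + (Y v + Y w) \<in> ?U ?N"
            using vw by (rule addN)
          then have "Y g + Y g' \<in> ?U ?N" by (simp add: ac_simps)
          with pN show False by simp
        qed
      qed
      have "independent_on (difference Y) (insert (g', w) (insert (g, v) ?N))"
      proof (rule independent_on_insert)
        show "difference Y (g', w) \<notin> ?U (insert (g, v) ?N)"
          unfolding difference_pair by (rule 2)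
      qed (use finN 1 fresh(2) in blast)+
      moreover have "pairing V (insert (g', w) (insert (g, v) ?N))"
      proof (rule pairing_insert)
        show "pairing V (insert (g, v) ?N)"
          by (rule pairing_insert[OF pairN]) (use gfresh rfresh that(1) in blast)+
      qed (use gfresh rfresh that(2) \<open>v \<noteq> w\<close> in
          \<open>(unfold image_insert fst_conv snd_conv)?, blast\<close>)+
      moreover have "card (insert (g', w) (insert (g, v) ?N)) = Suc (card M)"
      proof -
        have "card (insert (g', w) (insert (g, v) ?N)) = Suc (Suc (card ?N))"
          using fresh finN by (metis card_insert_disjoint finite_insert)
        also have "Suc (card ?N) = card M" using finM p by (rule card_Suc_Diff1)
        finally show ?thesis .
      qed
      ultimately show False using maxM[of "insert (g', w) (insert (g, v) ?N)"] by linarith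
    qed
    \<comment> \<open>By \<open>exchange\<close>, differences of distinct unpaired elements all lie
      in the nontrivial coset of the span of \<open>?N\<close>; but two such differences add up to
      an element of that span.\<close>
    have diff: "Y v + Y w + (Y g + Y g') \<in> ?U ?N" if "v \<in> ?R" "w \<in> ?R" "v \<noteq> w" for v w
      using subset_sums_insert[OF finN, of "Y v + Y w" "difference Y" "(g, g')"] exchange[of v w] RU[of v w]
        that Minsert by (auto simp: difference_def)
    have "(Y x + Y y + (Y g + Y g')) + (Y y + Y z + (Y g + Y g')) \<in> ?U ?N"
      by (rule addN; rule diff) (use xyz in auto)
    then have "Y x + Y z \<in> ?U ?N" by (simp add: ac_simps)
    with exchange[of x z] xyz show False by auto
  qed
  have "Y v + Y x \<in> ?U M" if "v \<in> V" for v
  proof -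
    consider "v \<in> ?R" | "v \<in> fst ` M" | "v \<in> snd ` M" using \<open>v \<in> V\<close> by blast
    then show ?thesis
    proof cases
      case 1
      then show ?thesis using RU xyz by auto
    next
      case 2
      then show ?thesis using pair by auto
    next
      case 3
      then obtain g where g: "(g, v) \<in> M" by auto
      then have "(Y g + Y v) + (Y g + Y x) \<in> ?U M"
        using subset_sums_self[OF g, of "difference Y"] pair[OF g]
        by (simp add: addM difference_def)
      then show ?thesis by (simp add: ac_simps)
    qed
  qed
  with that show ?thesis by blast
qed

text \<open>A maximum pairing has at most \<open>k\<close> pairs. If it has exactly
  \<open>k\<close>, its differences span all of \<open>A\<close>, which then serves as the coset.
  Otherwise at least three elements are unpaired, and \<open>maximal_pairing_coset\<close>
  applies.\<close>

lemma zero_sum_subset_exists: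
  fixes Y :: "'v \<Rightarrow> 'a::elementary_2_group"
  assumes fin: "finite V" and A: "subgroup2 A" "finite A" "card A \<le> 2 ^ k" "Y ` V \<subseteq> A"
    and "k \<le> t" "2 * k + 1 \<le> card V" "t + k \<le> card V"
    and par: "even t \<or> odd (card V) \<and> sum Y V = 0"
  obtains S where "S \<subseteq> V" "card S = t" "sum Y S = 0"
proof -
  obtain M where M: "pairing V M" "independent_on (difference Y) M"
    "\<And>N. pairing V N \<Longrightarrow> independent_on (difference Y) N \<Longrightarrow> card N \<le> card M"
    using maximal_pairing[OF fin] by blast
  have finM: "finite M" using M(1) fin by (rule pairing_finite)
  have MA: "difference Y p \<in> A" if "p \<in> M" for p
  proof -
    have "fst p \<in> V" "snd p \<in> V" using that M(1) unfolding pairing_def by blast+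
    then show ?thesis using A(4) unfolding difference_def by (intro subgroup2_add[OF A(1)]) auto
  qed
  have "card M \<le> k" using card_independent_le[OF finM M(2) A(1-3) MA] .
  obtain a where a: "\<And>v. v \<in> V \<Longrightarrow> Y v + a \<in> subset_sums (difference Y) M"
  proof (cases "card M = k")
    case True
    have "subset_sums (difference Y) M \<subseteq> A" using A(1) MA by (rule subset_sums_subset)
    then have "subset_sums (difference Y) M = A"
      using A(2,3) by (intro card_seteq) (simp_all add: card_subset_sums finM M(2) True)
    then show ?thesis using A(4) that[of 0] by auto
  next
    case False
    then have "2 * card M + 3 \<le> card V" using \<open>card M \<le> k\<close> assms(7) by linarith
    then show ?thesis using maximal_pairing_coset[OF fin M] that by blast
  qed
  have "card M \<le> t" "t + card M \<le> card V" using \<open>card M \<le> k\<close> assms(6,8) by linarith+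
  from zero_sum_subset_of_pairing[OF fin M(1) a this par] that show ?thesis by blast
qed

section \<open>Colourings and vectors\<close>

definition cut :: "'v set \<Rightarrow> 'v set \<Rightarrow> 'v set set" where
  "cut V S = {{u, v} | u v. u \<in> S \<and> v \<in> V - S}"

lemma cut_subset_nsets: "S \<subseteq> V \<Longrightarrow> cut V S \<subseteq> nsets V 2"
  unfolding cut_def by auto

lemma mem_cut_iff:
  assumes "S \<subseteq> V" "e \<in> nsets V 2"
  shows "e \<in> cut V S \<longleftrightarrow> odd (card {v \<in> S. v \<in> e})"
proof -
  obtain x y where e: "e = {x, y}" "x \<in> V" "y \<in> V" "x \<noteq> y"
    using assms(2) by (rule nsets2_E)
  have "{x, y} \<in> cut V S \<longleftrightarrow> (x \<in> S \<longleftrightarrow> y \<notin> S)"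
    using e assms(1) unfolding cut_def by (auto simp: doubleton_eq_iff)
  moreover have "{v \<in> S. v \<in> e} = (if x \<in> S then {x} else {}) \<union> (if y \<in> S then {y} else {})"
    using e by auto
  ultimately show ?thesis using e by auto
qed

lemma card_cut:
  assumes "finite V" "S \<subseteq> V"
  shows "card (cut V S) = card S * (card V - card S)"
proof -
  have fin: "finite S" using assms by (rule rev_finite_subset)
  have "cut V S = (\<lambda>(u, v). {u, v}) ` (S \<times> (V - S))"
    unfolding cut_def by auto
  moreover have "inj_on (\<lambda>(u, v). {u, v}) (S \<times> (V - S))"
    by (auto simp: inj_on_def doubleton_eq_iff)
  ultimately show ?thesis
    using assms fin by (simp add: card_image card_cartesian_product card_Diff_subset)
qed

text \<open>Double counting: the degree sum over \<open>S\<close> counts each edge once per endpoint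
  in \<open>S\<close>, so modulo two only the edges with exactly one endpoint in \<open>S\<close>
  remain.\<close>

lemma degree_sum_parity:
  assumes "finite V" "S \<subseteq> V" "E \<subseteq> nsets V 2"
  shows "even (\<Sum>v\<in>S. card {e \<in> E. v \<in> e}) \<longleftrightarrow> even (card (cut V S \<inter> E))"
proof -
  have fin: "finite S" "finite E"
    using assms by (auto intro: finite_subset finite_imp_finite_nsets)
  have "(\<Sum>v\<in>S. card {e \<in> E. v \<in> e}) = (\<Sum>e\<in>E. card {v \<in> S. v \<in> e})"
    using fin by (intro sum_multicount_gen) auto
  then have "even (\<Sum>v\<in>S. card {e \<in> E. v \<in> e}) \<longleftrightarrow> even (card {e \<in> E. odd (card {v \<in> S. v \<in> e})})"
    using fin by (simp add: even_sum_iff)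
  also have "{e \<in> E. odd (card {v \<in> S. v \<in> e})} = cut V S \<inter> E"
    using mem_cut_iff[OF assms(2)] assms(3) by blast
  finally show ?thesis .
qed

lemma mem_complete_bipartite_iff:
  "{x, y} \<in> edges (complete_bipartite s m) \<longleftrightarrow>
     x \<in> {1..s} \<and> y \<in> {s + 1..s + m} \<or> y \<in> {1..s} \<and> x \<in> {s + 1..s + m}"
  unfolding complete_bipartite_def snd_conv mem_Collect_eq doubleton_eq_iff by blast

text \<open>A copy has \<open>n\<close> vertices and is therefore spanning; \<open>S\<close> is the
  preimage of the first part under the isomorphism.\<close>

lemma copy_of_complete_bipartite:
  assumes "is_copy n (complete_bipartite s (n - s)) G" "s \<le> n"
  obtains S where "S \<subseteq> {1..n}" "card S = s" "edges G = cut {1..n} S"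
proof -
  have sub: "edges G \<subseteq> nsets (verts G) 2" "verts G \<subseteq> {1..n}"
    using assms(1) by (auto simp: is_copy_def subgraph_def simple_graph_def complete_graph_def)
  obtain f where f: "bij_betw f (verts G) {1..n}" and
    fe: "\<And>u v. u \<in> verts G \<Longrightarrow> v \<in> verts G \<Longrightarrow>
      {u, v} \<in> edges G \<longleftrightarrow> {f u, f v} \<in> edges (complete_bipartite s (n - s))"
    using assms by (auto simp: is_copy_def isomorphic_def complete_bipartite_def)
  have "card (verts G) = n" using bij_betw_same_card[OF f] by simp
  with sub(2) have vG: "verts G = {1..n}" by (intro card_subset_eq) auto
  define S where "S = {v \<in> {1..n}. f v \<le> s}"
  have "f ` S = {1..s}"
  proof
    show "f ` S \<subseteq> {1..s}" using f unfolding S_def vG bij_betw_def by force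
    show "{1..s} \<subseteq> f ` S"
    proof
      fix x assume x: "x \<in> {1..s}"
      then have "x \<in> f ` {1..n}" using f assms(2) unfolding vG bij_betw_def by auto
      with x show "x \<in> f ` S" unfolding S_def by auto
    qed
  qed
  moreover have "inj_on f S" using f unfolding vG bij_betw_def S_def by (auto intro: inj_on_subset)
  ultimately have "card S = s" by (metis card_atLeastAtMost card_image diff_Suc_1)
  have range: "f v \<in> {1..n}" if "v \<in> {1..n}" for v using f that unfolding vG bij_betw_def by blast
  have key: "{u, v} \<in> edges G \<longleftrightarrow> (u \<in> S \<longleftrightarrow> v \<notin> S)" if "u \<in> {1..n}" "v \<in> {1..n}" for u v
  proof -
    have "{f u, f v} \<in> edges (complete_bipartite s (n - s)) \<longleftrightarrow>
        f u \<le> s \<and> s < f v \<or> f v \<le> s \<and> s < f u"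
      using range[OF that(1)] range[OF that(2)] assms(2) unfolding mem_complete_bipartite_iff by auto
    with fe[of u v] that show ?thesis unfolding vG S_def by auto
  qed
  have "edges G = cut {1..n} S"
  proof (intro equalityI subsetI)
    fix e assume e: "e \<in> edges G"
    then have "e \<in> nsets {1..n} 2" using sub vG by auto
    then obtain x y where "e = {x, y}" "x \<in> {1..n}" "y \<in> {1..n}" by (rule nsets2_E)
    with e key[of x y] show "e \<in> cut {1..n} S" unfolding cut_def by (auto simp: insert_commute)
  next
    fix e assume "e \<in> cut {1..n} S"
    then obtain u v where "e = {u, v}" "u \<in> S" "v \<in> {1..n} - S" by (auto simp: cut_def)
    with key[of u v] show "e \<in> edges G" unfolding S_def by auto
  qed
  moreover have "S \<subseteq> {1..n}" by (auto simp: S_def)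
  ultimately show ?thesis using that \<open>card S = s\<close> by blast
qed

text \<open>Bijections of \<open>S\<close> and of its complement onto the two parts are glued
  together.\<close>

lemma cut_is_copy:
  assumes "S \<subseteq> {1..n}"
  shows "is_copy n (complete_bipartite (card S) (n - card S)) ({1..n}, cut {1..n} S)"
proof -
  let ?s = "card S"
  have fin: "finite S" and le: "?s \<le> n"
    using assms card_mono[OF _ assms] finite_subset by auto
  obtain g where g: "bij_betw g S {1..?s}"
    using finite_same_card_bij[OF fin, of "{1..?s}"] by auto
  have "card ({1..n} - S) = card {?s + 1..n}" using assms fin by (simp add: card_Diff_subset)
  then obtain h where h: "bij_betw h ({1..n} - S) {?s + 1..n}"
    using finite_same_card_bij[of "{1..n} - S" "{?s + 1..n}"] by auto
  define f where "f v = (if v \<in> S then g v else h v)" for v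
  have "bij_betw f S {1..?s}" using g by (rule bij_betw_cong[THEN iffD2, rotated]) (simp add: f_def)
  moreover have "bij_betw f ({1..n} - S) {?s + 1..n}"
    using h by (rule bij_betw_cong[THEN iffD2, rotated]) (simp add: f_def)
  ultimately have "bij_betw f (S \<union> ({1..n} - S)) ({1..?s} \<union> {?s + 1..n})"
    by (rule bij_betw_combine) auto
  moreover have "S \<union> ({1..n} - S) = {1..n}" "{1..?s} \<union> {?s + 1..n} = {1..n}" using assms le by auto
  ultimately have f: "bij_betw f {1..n} {1..n}" by simp
  have mem: "f v \<in> {1..?s} \<longleftrightarrow> v \<in> S" "f v \<in> {?s + 1..n} \<longleftrightarrow> v \<notin> S" if "v \<in> {1..n}" for v
  proof -
    have "f v \<in> (if v \<in> S then {1..?s} else {?s + 1..n})"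
      using bij_betwE[OF g] bij_betwE[OF h] that by (simp add: f_def)
    then show "f v \<in> {1..?s} \<longleftrightarrow> v \<in> S" "f v \<in> {?s + 1..n} \<longleftrightarrow> v \<notin> S"
      by (auto split: if_splits)
  qed
  have "{u, v} \<in> cut {1..n} S \<longleftrightarrow> {f u, f v} \<in> edges (complete_bipartite ?s (n - ?s))"
    if "u \<in> {1..n}" "v \<in> {1..n}" for u v
  proof -
    have "{f u, f v} \<in> edges (complete_bipartite ?s (n - ?s)) \<longleftrightarrow> (u \<in> S \<longleftrightarrow> v \<notin> S)"
      using mem[OF that(1)] mem[OF that(2)] le unfolding mem_complete_bipartite_iff by auto
    moreover have "{u, v} \<in> cut {1..n} S \<longleftrightarrow> (u \<in> S \<longleftrightarrow> v \<notin> S)"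
      using that unfolding cut_def by (auto simp: doubleton_eq_iff)
    ultimately show ?thesis by simp
  qed
  then have "isomorphic ({1..n}, cut {1..n} S) (complete_bipartite ?s (n - ?s))"
    unfolding isomorphic_def using f le by (intro exI[of _ f]) (auto simp: complete_bipartite_def)
  then show ?thesis
    using cut_subset_nsets[OF assms]
    by (auto simp: is_copy_def subgraph_def simple_graph_def complete_graph_def)
qed

section \<open>The odd-Ramsey condition in terms of cuts\<close>

definition odd_colouring :: "nat \<Rightarrow> nat set \<Rightarrow> nat \<Rightarrow> (nat \<Rightarrow> nat set set) \<Rightarrow> bool" where
  "odd_colouring n T r c \<longleftrightarrow> colouring n r c \<and>
     (\<forall>S\<subseteq>{1..n}. card S \<in> T \<longrightarrow> (\<exists>i\<in>{1..r}. odd (card (cut {1..n} S \<inter> c i))))"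

lemma r_odd_bipartite_family:
  assumes "T \<subseteq> {..n}"
  shows "r_odd n (bipartite_family n T) = (LEAST r. r \<ge> 1 \<and> (\<exists>c. odd_colouring n T r c))"
proof -
  have "(\<forall>H\<in>bipartite_family n T. \<forall>G. is_copy n H G \<longrightarrow> has_odd_colour_class r c G) \<longleftrightarrow>
      (\<forall>S\<subseteq>{1..n}. card S \<in> T \<longrightarrow> (\<exists>i\<in>{1..r}. odd (card (cut {1..n} S \<inter> c i))))" (is "?L \<longleftrightarrow> ?R")
    for r c
  proof
    assume L: ?L
    show ?R
    proof (intro allI impI)
      fix S assume S: "S \<subseteq> {1..n}" "card S \<in> T"
      then have "has_odd_colour_class r c ({1..n}, cut {1..n} S)"
        using L cut_is_copy[OF S(1)] by (auto simp: bipartite_family_def)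
      then show "\<exists>i\<in>{1..r}. odd (card (cut {1..n} S \<inter> c i))" by (simp add: has_odd_colour_class_def)
    qed
  next
    assume R: ?R
    show ?L
    proof (intro ballI allI impI)
      fix H G assume "H \<in> bipartite_family n T" and G: "is_copy n H G"
      then obtain s where s: "s \<in> T" "H = complete_bipartite s (n - s)" by (auto simp: bipartite_family_def)
      with assms have "s \<le> n" by auto
      with G s obtain S where "S \<subseteq> {1..n}" "card S = s" "edges G = cut {1..n} S"
        using copy_of_complete_bipartite by metis
      with R s show "has_odd_colour_class r c G" by (auto simp: has_odd_colour_class_def)
    qed
  qed
  then show ?thesis unfolding r_odd_def odd_colouring_def by simp
qed

section \<open>Vectors over the field with two elements\<close>

instance bit :: elementary_2_group
proof
  show "x + x = 0" for x :: bit by (cases x) simp_all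
qed

instance "fun" :: (type, elementary_2_group) elementary_2_group
  by standard (simp add: fun_eq_iff)

lemma sum_fun_apply: "(\<Sum>x\<in>I. f x) i = (\<Sum>x\<in>I. f x i)"
  by (induction I rule: infinite_finite_induct) auto

lemma of_nat_bit: "(of_nat m :: bit) = of_bool (odd m)"
  by (induction m) auto

text \<open>A space of given dimension is the span of finitely many of these inside
  \<open>nat \<Rightarrow> bit\<close>, so the dimension is a term and not part of the type.\<close>

definition unit_vector :: "nat \<Rightarrow> nat \<Rightarrow> bit" where
  "unit_vector i = (\<lambda>j. of_bool (i = j))"

lemma sum_unit_vector: "finite J \<Longrightarrow> sum unit_vector J = (\<lambda>j. of_bool (j \<in> J))"
  by (simp add: fun_eq_iff sum_fun_apply unit_vector_def of_bool_def sum.delta)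

text \<open>The group \<open>A\<close> plays the role of the space of dimension \<open>k\<close> over the field with two elements.\<close>

definition avoiding :: "nat \<Rightarrow> nat set \<Rightarrow> nat \<Rightarrow> 'a set \<Rightarrow> (nat \<Rightarrow> 'a::elementary_2_group) \<Rightarrow> bool" where
  "avoiding n T k A Y \<longleftrightarrow> subgroup2 A \<and> finite A \<and> card A \<le> 2 ^ k \<and> Y ` {1..n} \<subseteq> A \<and>
     sum Y {1..n} = 0 \<and> (\<forall>S. S \<subseteq> {1..n} \<longrightarrow> card S \<in> T \<longrightarrow> sum Y S \<noteq> 0)"

text \<open>The last colour needs no coordinate: its parity in a cut follows from the parity of \<open>s (n - s)\<close>.\<close>

lemma colouring_imp_vectors:
  assumes "odd_colouring n T r c" "r \<ge> 1" and even: "\<And>s. s \<in> T \<Longrightarrow> even (s * (n - s))"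
  shows "\<exists>A (Y :: nat \<Rightarrow> nat \<Rightarrow> bit). avoiding n T (r - 1) A Y"
proof -
  let ?I = "{1..<r}" and ?V = "{1..n}"
  define Y :: "nat \<Rightarrow> nat \<Rightarrow> bit" where
    "Y v = (\<lambda>i. if i \<in> ?I then of_nat (card {e \<in> c i. v \<in> e}) else 0)" for v
  let ?A = "subset_sums unit_vector ?I"
  have col: "disjoint_family_on c {1..r}" "(\<Union>i\<in>{1..r}. c i) = nsets ?V 2"
    using assms(1) by (auto simp: odd_colouring_def colouring_def complete_graph_def)
  have sub: "c i \<subseteq> nsets ?V 2" if "i \<in> {1..r}" for i using col that by blast
  have zero_iff: "sum Y S = 0 \<longleftrightarrow> (\<forall>i\<in>?I. even (card (cut ?V S \<inter> c i)))" if "S \<subseteq> ?V" for S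
  proof -
    have "sum Y S i = (if i \<in> ?I then of_nat (\<Sum>v\<in>S. card {e \<in> c i. v \<in> e}) else 0)" for i
      by (simp add: sum_fun_apply Y_def del: atLeastLessThan_iff)
    then have "sum Y S = 0 \<longleftrightarrow> (\<forall>i\<in>?I. even (\<Sum>v\<in>S. card {e \<in> c i. v \<in> e}))"
      by (auto simp: fun_eq_iff of_nat_bit simp del: of_nat_sum)
    also have "\<dots> \<longleftrightarrow> (\<forall>i\<in>?I. even (card (cut ?V S \<inter> c i)))"
      using degree_sum_parity[OF _ that sub] by auto
    finally show ?thesis .
  qed
  have "avoiding n T (r - 1) ?A Y"
    unfolding avoiding_def
  proof (intro conjI allI impI)
    show "subgroup2 ?A" by (rule subgroup2_subset_sums) simp
    show "finite ?A" unfolding subset_sums_def by simp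
    show "card ?A \<le> 2 ^ (r - 1)"
      using card_subset_sums_le[of ?I unit_vector] by simp
    show "Y ` ?V \<subseteq> ?A"
    proof
      fix y assume "y \<in> Y ` ?V"
      then obtain v where v: "y = Y v" by auto
      have "Y v = sum unit_vector {i \<in> ?I. odd (card {e \<in> c i. v \<in> e})}"
        by (subst sum_unit_vector) (auto simp: Y_def fun_eq_iff of_nat_bit)
      then show "y \<in> ?A" unfolding subset_sums_def v by blast
    qed
    show "sum Y ?V = 0" by (subst zero_iff) (auto simp: cut_def)
    fix S assume S: "S \<subseteq> ?V" "card S \<in> T"
    show "sum Y S \<noteq> 0"
    proof
      assume "sum Y S = 0"
      then have ev: "\<forall>i\<in>?I. even (card (cut ?V S \<inter> c i))" using zero_iff[OF S(1)] by simp
      have finc: "finite (cut ?V S \<inter> c i)" for i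
        using cut_subset_nsets[OF S(1)] by (meson finite_Int finite_atLeastAtMost finite_imp_finite_nsets finite_subset)
      \<comment> \<open>The classes partition the cut, whose size is even; if the first
        \<open>r - 1\<close> parts are even, so is the last.\<close>
      have "cut ?V S = (\<Union>i\<in>{1..r}. cut ?V S \<inter> c i)"
        using cut_subset_nsets[OF S(1)] col(2) by auto
      also have "card \<dots> = (\<Sum>i\<in>{1..r}. card (cut ?V S \<inter> c i))"
        using col(1) finc by (intro card_UN_disjoint) (auto simp: disjoint_family_on_def)
      also have "{1..r} = insert r ?I" using \<open>r \<ge> 1\<close> by auto
      finally have "card (cut ?V S) = card (cut ?V S \<inter> c r) + (\<Sum>i\<in>?I. card (cut ?V S \<inter> c i))"
        by simp
      moreover have "even (card (cut ?V S))" using even[OF S(2)] S(1) by (simp add: card_cut)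
      moreover have "even (\<Sum>i\<in>?I. card (cut ?V S \<inter> c i))" using ev by (intro dvd_sum) auto
      ultimately have "even (card (cut ?V S \<inter> c r))" by simp
      with ev \<open>{1..r} = insert r ?I\<close> have "\<forall>i\<in>{1..r}. even (card (cut ?V S \<inter> c i))" by auto
      with assms(1) S show False unfolding odd_colouring_def by blast
    qed
  qed
  then show ?thesis by blast
qed

text \<open>Writing every vector in terms of a basis \<open>B\<close> chosen among the given vectors, let the \<open>x\<close>-th colour
  class be the star from \<open>x \<in> B\<close> to the vertices outside \<open>B\<close> whose vector involves \<open>x\<close>. These stars
  are edge-disjoint, and since the vectors sum to zero, their centres have odd degree, as
  required of basis vectors. All remaining edges get one further colour.\<close>

lemma vectors_imp_colouring:
  fixes Y :: "nat \<Rightarrow> 'a::elementary_2_group"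
  assumes "avoiding n T k A Y"
  shows "\<exists>r c. 1 \<le> r \<and> r \<le> k + 1 \<and> odd_colouring n T r c"
proof -
  let ?V = "{1..n}"
  have A: "subgroup2 A" "finite A" "card A \<le> 2 ^ k" "Y ` ?V \<subseteq> A" and zero: "sum Y ?V = 0"
    and nonzero: "\<And>S. S \<subseteq> ?V \<Longrightarrow> card S \<in> T \<Longrightarrow> sum Y S \<noteq> 0"
    using assms by (simp_all add: avoiding_def)
  obtain B where B: "B \<subseteq> ?V" "independent_on Y B" "\<And>v. v \<in> ?V \<Longrightarrow> Y v \<in> subset_sums Y B"
    using maximal_independent_subset[of ?V Y] by auto
  have finB: "finite B" using B(1) finite_subset by blast
  have "card B \<le> k" using A B(1) by (intro card_independent_le[OF finB B(2) A(1-3)]) auto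
  have "\<exists>J\<subseteq>B. sum Y J = Y v" if "v \<in> ?V" for v
    using B(3)[OF that] unfolding subset_sums_def by (metis PowD imageE)
  then obtain rep' where rep': "\<And>v. v \<in> ?V \<Longrightarrow> rep' v \<subseteq> B \<and> sum Y (rep' v) = Y v" by metis
  define rep where "rep v = (if v \<in> B then {v} else rep' v)" for v
  have rep: "rep v \<subseteq> B" "sum Y (rep v) = Y v" if "v \<in> ?V" for v
    using rep'[OF that] by (auto simp: rep_def)
  have rep_B: "rep v = {v}" if "v \<in> B" for v using that by (simp add: rep_def)
  \<comment> \<open>Expand each vector in the basis and exchange the sums; by independence every
    basis vector must occur an even number of times.\<close>
  have zero_iff: "sum Y S = 0 \<longleftrightarrow> (\<forall>x\<in>B. even (card {v \<in> S. x \<in> rep v}))" if S: "S \<subseteq> ?V" for S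
  proof -
    have finS: "finite S" using S finite_subset by blast
    have "sum Y S = (\<Sum>v\<in>S. \<Sum>x\<in>{x \<in> B. x \<in> rep v}. Y x)"
    proof (rule sum.cong[OF refl])
      fix v assume "v \<in> S"
      then have "{x \<in> B. x \<in> rep v} = rep v" using rep S by blast
      then show "Y v = (\<Sum>x\<in>{x \<in> B. x \<in> rep v}. Y x)" using rep(2)[of v] \<open>v \<in> S\<close> S by auto
    qed
    also have "\<dots> = (\<Sum>x\<in>B. \<Sum>v\<in>{v \<in> S. x \<in> rep v}. Y x)"
      using finS finB by (rule sum.swap_restrict)
    also have "\<dots> = (\<Sum>x\<in>B. if odd (card {v \<in> S. x \<in> rep v}) then Y x else 0)"
      using finS by (intro sum.cong) (auto simp: sum_const_parity)
    also have "\<dots> = sum Y {x \<in> B. odd (card {v \<in> S. x \<in> rep v})}"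
      using finB by (simp add: sum.inter_filter)
    finally have eq: "sum Y S = sum Y {x \<in> B. odd (card {v \<in> S. x \<in> rep v})}" .
    show ?thesis
    proof
      assume "sum Y S = 0"
      with eq have "{x \<in> B. odd (card {v \<in> S. x \<in> rep v})} = {}"
        using B(2) unfolding independent_on_def by (metis (no_types, lifting) mem_Collect_eq subsetI)
      then show "\<forall>x\<in>B. even (card {v \<in> S. x \<in> rep v})" by blast
    next
      assume "\<forall>x\<in>B. even (card {v \<in> S. x \<in> rep v})"
      then have "{x \<in> B. odd (card {v \<in> S. x \<in> rep v})} = {}" by blast
      with eq show "sum Y S = 0" by simp
    qed
  qed
  define W where "W x = {v \<in> ?V - B. x \<in> rep v}" for x
  \<comment> \<open>Evenly many vertices involve \<open>x\<close> because the total sum is zero, and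
    \<open>x\<close> is the only one of them in \<open>B\<close>.\<close>
  have oddW: "odd (card (W x))" if "x \<in> B" for x
  proof -
    have "{v \<in> ?V. x \<in> rep v} = insert x (W x)" using that B(1) rep_B by (auto simp: W_def)
    moreover have "x \<notin> W x" "finite (W x)" using that by (auto simp: W_def)
    ultimately show ?thesis using zero_iff[of ?V] zero that by auto
  qed
  define star where "star x = (\<lambda>v. {x, v}) ` W x" for x
  \<comment> \<open>Degree parities in the stars recover the coordinates: odd at the centre by
    \<open>oddW\<close>, zero at the other basis vertices, and 1 or 0 outside
    \<open>B\<close>.\<close>
  have star_degree: "odd (card {e \<in> star x. v \<in> e}) \<longleftrightarrow> x \<in> rep v" if x: "x \<in> B" and v: "v \<in> ?V" for x v
  proof -
    consider "v = x" | "v \<in> B" "v \<noteq> x" | "v \<notin> B" "x \<in> rep v" | "v \<notin> B" "x \<notin> rep v" by blast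
    then show ?thesis
    proof cases
      case 1
      then have "{e \<in> star x. v \<in> e} = star x" by (auto simp: star_def)
      moreover have "card (star x) = card (W x)"
        unfolding star_def by (rule card_image) (auto simp: inj_on_def doubleton_eq_iff)
      ultimately show ?thesis using oddW[OF x] 1 rep_B[OF x] by simp
    next
      case 2
      then have none: "{e \<in> star x. v \<in> e} = {}" by (auto simp: star_def W_def)
      show ?thesis using 2 rep_B unfolding none by auto
    next
      case 3
      then have one: "{e \<in> star x. v \<in> e} = {{x, v}}" using x v by (auto simp: star_def W_def)
      show ?thesis using 3 unfolding one by simp
    next
      case 4
      then have none: "{e \<in> star x. v \<in> e} = {}" using x by (auto simp: star_def W_def)
      show ?thesis using 4 unfolding none by simp
    qed
  qed
  have star_sub: "star x \<subseteq> nsets ?V 2" if "x \<in> B" for x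
    using that B(1) by (auto simp: star_def W_def)
  have star_disj: "star x \<inter> star y = {}" if "x \<in> B" "y \<in> B" "x \<noteq> y" for x y
    using that by (auto simp: star_def W_def doubleton_eq_iff)
  obtain b where b: "bij_betw b {1..card B} B"
    using ex_bij_betw_nat_finite_1[OF finB] by blast
  let ?r = "card B + 1"
  define c where "c i = (if i \<in> {1..card B} then star (b i) else nsets ?V 2 - (\<Union>x\<in>B. star x))" for i
  have c_star: "c i = star (b i)" if "i \<in> {1..card B}" for i using that unfolding c_def by (rule if_P)
  have bB: "b i \<in> B" if "i \<in> {1..card B}" for i using b that by (auto simp: bij_betw_def)
  have "odd_colouring n T ?r c"
    unfolding odd_colouring_def
  proof (intro conjI allI impI)
    have "c i \<inter> c j = {}" if "i \<noteq> j" "i \<in> {1..?r}" "j \<in> {1..?r}" for i j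
    proof (cases "i \<in> {1..card B} \<and> j \<in> {1..card B}")
      case True
      then have "b i \<noteq> b j" using inj_onD[OF bij_betw_imp_inj_on[OF b], of i j] \<open>i \<noteq> j\<close> by blast
      then have "star (b i) \<inter> star (b j) = {}" using True by (intro star_disj bB) auto
      then show ?thesis using True c_star by metis
    next
      case False
      moreover have "i = ?r \<or> i \<in> {1..card B}" "j = ?r \<or> j \<in> {1..card B}" using that by auto
      ultimately consider "i \<in> {1..card B}" "j \<notin> {1..card B}" | "i \<notin> {1..card B}" "j \<in> {1..card B}"
        using \<open>i \<noteq> j\<close> by blast
      then show ?thesis using bB[of i] bB[of j] unfolding c_def by cases auto
    qed
    moreover have "(\<Union>i\<in>{1..?r}. c i) = nsets ?V 2"
    proof -
      have "{1..?r} = insert ?r {1..card B}" by auto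
      moreover have "(\<Union>i\<in>{1..card B}. c i) = (\<Union>x\<in>B. star x)"
        using b unfolding bij_betw_def by (force simp: c_def)
      moreover have "c ?r = nsets ?V 2 - (\<Union>x\<in>B. star x)" by (simp add: c_def)
      ultimately have "(\<Union>i\<in>{1..?r}. c i) = (nsets ?V 2 - (\<Union>x\<in>B. star x)) \<union> (\<Union>x\<in>B. star x)" by simp
      then show ?thesis using star_sub by auto
    qed
    ultimately show "colouring n ?r c"
      by (auto simp: colouring_def complete_graph_def disjoint_family_on_def)
  next
    fix S assume S: "S \<subseteq> ?V" "card S \<in> T"
    then have finS: "finite S" using finite_subset by blast
    obtain x where x: "x \<in> B" "odd (card {v \<in> S. x \<in> rep v})"
      using nonzero[OF S] zero_iff[OF S(1)] by auto
    have "x \<in> b ` {1..card B}" using bij_betw_imp_surj_on[OF b] x(1) by simp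
    then obtain i where i: "i \<in> {1..card B}" "b i = x" by blast
    have "{v \<in> S. odd (card {e \<in> star x. v \<in> e})} = {v \<in> S. x \<in> rep v}"
      by (rule Collect_cong, rule conj_cong[OF refl], rule star_degree[OF x(1)]) (use S(1) in blast)
    then have "odd (\<Sum>v\<in>S. card {e \<in> star x. v \<in> e})"
      using x(2) finS by (simp add: even_sum_iff)
    then have "odd (card (cut ?V S \<inter> star x))"
      using degree_sum_parity[OF _ S(1) star_sub[OF x(1)]] by simp
    then have "odd (card (cut ?V S \<inter> c i))" using i by (simp add: c_star)
    then show "\<exists>i\<in>{1..?r}. odd (card (cut ?V S \<inter> c i))" using i by auto
  qed
  then show ?thesis using \<open>card B \<le> k\<close> by (intro exI[of _ ?r] exI[of _ c]) simp
qed

section \<open>Simplex configurations and exact bounds\<close>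

lemma avoiding_imp_r_odd_le:
  assumes "T \<subseteq> {..n}" "avoiding n T k A Y"
  shows "r_odd n (bipartite_family n T) \<le> k + 1"
proof -
  obtain r c where "1 \<le> r" "r \<le> k + 1" "odd_colouring n T r c"
    using vectors_imp_colouring[OF assms(2)] by blast
  then have "(LEAST r. r \<ge> 1 \<and> (\<exists>c. odd_colouring n T r c)) \<le> r" by (intro Least_le) blast
  with \<open>r \<le> k + 1\<close> show ?thesis by (simp add: r_odd_bipartite_family assms(1))
qed

lemma sum_of_bool_eq: "finite S \<Longrightarrow> (\<Sum>v\<in>S. of_bool (v = j) :: bit) = of_bool (j \<in> S)"
  by (simp add: of_bool_def sum.delta)

text \<open>Take \<open>q - 1\<close> unit vectors, their sum, and \<open>n - q\<close> zero
  vectors. A zero-sum set contains all or none of the first \<open>q\<close> vertices, so its size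
  is at least \<open>q\<close> or at most \<open>n - q\<close>.\<close>

lemma simplex_vectors:
  assumes "1 \<le> q" "q \<le> n" and T: "\<And>s. s \<in> T \<Longrightarrow> n - q < s \<and> s < q"
  shows "\<exists>A (Y :: nat \<Rightarrow> nat \<Rightarrow> bit). avoiding n T (q - 1) A Y"
proof -
  let ?I = "{1..<q}"
  let ?A = "subset_sums unit_vector ?I"
  define Y where "Y v = (if v \<in> ?I then unit_vector v else if v = q then sum unit_vector ?I else 0)" for v
  have A: "subgroup2 ?A" by (rule subgroup2_subset_sums) simp
  have "avoiding n T (q - 1) ?A Y"
    unfolding avoiding_def
  proof (intro conjI allI impI)
    show "subgroup2 ?A" by (rule A)
    show "finite ?A" unfolding subset_sums_def by simp
    show "card ?A \<le> 2 ^ (q - 1)" using card_subset_sums_le[of ?I unit_vector] by simp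
    have "Y v \<in> ?A" for v
      using A subset_sums_self[of v ?I unit_vector] unfolding Y_def subgroup2_def subset_sums_def by auto
    then show "Y ` {1..n} \<subseteq> ?A" by blast
    have "{1..n} = ?I \<union> {q} \<union> {q<..n}" using assms by auto
    then have "sum Y {1..n} = sum Y (?I \<union> {q}) + sum Y {q<..n}"
      by (simp only:) (rule sum.union_disjoint, auto)
    moreover have "sum Y {q<..n} = 0" by (intro sum.neutral) (auto simp: Y_def)
    moreover have "sum Y ?I = sum unit_vector ?I" by (intro sum.cong) (auto simp: Y_def)
    ultimately show "sum Y {1..n} = 0" by (simp add: Y_def)
    fix S assume S: "S \<subseteq> {1..n}" "card S \<in> T"
    show "sum Y S \<noteq> 0"
    proof
      assume zero: "sum Y S = 0"
      have fin: "finite S" using S(1) finite_subset by blast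
      have coord: "j \<in> S \<longleftrightarrow> q \<in> S" if "j \<in> ?I" for j
      proof -
        have "Y v j = of_bool (v = j) + of_bool (v = q)" for v
          using that by (auto simp: Y_def sum_unit_vector) (auto simp: unit_vector_def)
        then have "sum Y S j = of_bool (j \<in> S) + of_bool (q \<in> S)"
          using fin by (simp only: sum_fun_apply sum.distrib sum_of_bool_eq)
        with zero show ?thesis by (auto split: if_splits)
      qed
      show False
      proof (cases "q \<in> S")
        case True
        have "x \<in> S" if "x \<in> {1..q}" for x
          using that coord[of x] True by (cases "x = q") auto
        then have "{1..q} \<subseteq> S" by blast
        then have "q \<le> card S" using card_mono[OF fin, of "{1..q}"] by simp
        then show False using T[OF S(2)] by simp
      next
        case False
        have "x \<in> {q<..n}" if "x \<in> S" for x
          using that coord[of x] False S(1) by (cases "x < q"; cases "x = q") auto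
        then have "S \<subseteq> {q<..n}" by blast
        then have "card S \<le> n - q" using card_mono[of "{q<..n}" S] by simp
        then show False using T[OF S(2)] by simp
      qed
    qed
  qed
  then show ?thesis by blast
qed

lemma r_odd_le_simplex:
  assumes "1 \<le> q" "q \<le> n" "\<And>s. s \<in> T \<Longrightarrow> n - q < s \<and> s < q"
  shows "r_odd n (bipartite_family n T) \<le> q"
proof -
  have "T \<subseteq> {..n}" using assms(2,3) by fastforce
  with simplex_vectors[OF assms] avoiding_imp_r_odd_le[of T n "q - 1"] assms(1) show ?thesis by fastforce
qed

text \<open>The simplex configuration with \<open>q = n\<close> shows that some number of colours
  suffices, so the least one is attained.\<close>

lemma r_odd_avoiding:
  assumes "admissible n T"
  shows "\<exists>A (Y :: nat \<Rightarrow> nat \<Rightarrow> bit). avoiding n T (r_odd n (bipartite_family n T) - 1) A Y"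
proof -
  have T: "s \<ge> 1" "s \<le> n div 2" "even (s * (n - s))" if "s \<in> T" for s
    using assms that by (auto simp: admissible_def)
  have lt: "0 < s \<and> s < n" if "s \<in> T" for s using T[OF that] by auto
  then have "T \<subseteq> {..n}" by fastforce
  have "n \<ge> 1" using assms by (simp add: admissible_def)
  with simplex_vectors[of n n T] lt obtain A and Y :: "nat \<Rightarrow> nat \<Rightarrow> bit" where "avoiding n T (n - 1) A Y"
    by auto
  from vectors_imp_colouring[OF this] have "\<exists>r. r \<ge> 1 \<and> (\<exists>c. odd_colouring n T r c)" by blast
  from LeastI_ex[OF this] obtain c where
    "r_odd n (bipartite_family n T) \<ge> 1" "odd_colouring n T (r_odd n (bipartite_family n T)) c"
    unfolding r_odd_bipartite_family[OF \<open>T \<subseteq> {..n}\<close>] by blast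
  from colouring_imp_vectors[OF this(2,1) T(3)] show ?thesis .
qed

text \<open>With at most \<open>k + 1\<close> colours the vectors would lie in a space of at most
  \<open>2 ^ k\<close> elements, where \<open>zero_sum_subset_exists\<close> yields a forbidden set
  of size \<open>s\<close>.\<close>

lemma r_odd_ge:
  assumes T: "admissible n T" "s \<in> T" and "k \<le> s" "2 * k + 1 \<le> n" "s + k \<le> n" "even s \<or> odd n"
  shows "k + 2 \<le> r_odd n (bipartite_family n T)"
proof (rule ccontr)
  let ?r = "r_odd n (bipartite_family n T)"
  assume "\<not> k + 2 \<le> ?r"
  then have le: "(2::nat) ^ (?r - 1) \<le> 2 ^ k" by (intro power_increasing) auto
  obtain A and Y :: "nat \<Rightarrow> nat \<Rightarrow> bit" where Y: "avoiding n T (?r - 1) A Y"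
    using r_odd_avoiding[OF T(1)] by blast
  have A: "subgroup2 A" "finite A" "card A \<le> 2 ^ k" "Y ` {1..n} \<subseteq> A" and "sum Y {1..n} = 0"
    using Y le unfolding avoiding_def by (meson le_trans)+
  with assms(6) have par: "even s \<or> odd (card {1..n}) \<and> sum Y {1..n} = 0" by simp
  obtain S where "S \<subseteq> {1..n}" "card S = s" "sum Y S = 0"
    by (rule zero_sum_subset_exists[OF _ A assms(3) _ _ par]) (use assms(4,5) in simp_all)
  with Y T(2) show False by (auto simp: avoiding_def)
qed

text \<open>Take \<open>t + 1\<close> unit vectors, their sum, and evenly many further copies of the
  first one. Coordinates 2 to \<open>t + 1\<close> force a zero-sum set to contain all or none of
  the vertices 2 to \<open>t + 2\<close>. The former needs more than \<open>t\<close> elements; the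
  latter leaves an odd number of copies of one nonzero vector.\<close>

lemma r_odd_le_odd:
  assumes "odd n" "odd t" "t + 2 \<le> n" "T \<subseteq> {..t}" "\<And>s. s \<in> T \<Longrightarrow> odd s"
  shows "r_odd n (bipartite_family n T) \<le> t + 2"
proof -
  let ?I = "{1..t + 1}"
  let ?A = "subset_sums unit_vector ?I"
  define Y where
    "Y v = (if v \<in> ?I then unit_vector v else if v = t + 2 then sum unit_vector ?I else unit_vector 1)" for v
  have A: "subgroup2 ?A" by (rule subgroup2_subset_sums) simp
  have "avoiding n T (t + 1) ?A Y"
    unfolding avoiding_def
  proof (intro conjI allI impI)
    show "subgroup2 ?A" by (rule A)
    show "finite ?A" unfolding subset_sums_def by simp
    show "card ?A \<le> 2 ^ (t + 1)" using card_subset_sums_le[of ?I unit_vector] by simp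
    have "unit_vector 1 \<in> ?A" by (rule subset_sums_self) simp
    moreover have "sum unit_vector ?I \<in> ?A" unfolding subset_sums_def by blast
    ultimately have "Y v \<in> ?A" for v
      using subset_sums_self[of v ?I unit_vector] unfolding Y_def by metis
    then show "Y ` {1..n} \<subseteq> ?A" by blast
    have "{1..n} = ?I \<union> {t + 2} \<union> {t + 2<..n}" using assms by auto
    then have "sum Y {1..n} = sum Y (?I \<union> {t + 2}) + sum Y {t + 2<..n}"
      by (simp only:) (rule sum.union_disjoint, auto)
    moreover have "sum Y {t + 2<..n} = (\<Sum>v\<in>{t + 2<..n}. unit_vector 1)"
      by (intro sum.cong) (auto simp: Y_def)
    moreover have "\<dots> = 0" using assms(1-3) by (intro sum_const_even) simp
    moreover have "sum Y ?I = sum unit_vector ?I" by (intro sum.cong) (auto simp: Y_def)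
    ultimately show "sum Y {1..n} = 0" by (simp add: Y_def)
    fix S assume S: "S \<subseteq> {1..n}" "card S \<in> T"
    show "sum Y S \<noteq> 0"
    proof
      assume zero: "sum Y S = 0"
      have fin: "finite S" using S(1) finite_subset by blast
      have coord: "j \<in> S \<longleftrightarrow> t + 2 \<in> S" if "j \<in> {2..t + 1}" for j
      proof -
        have "Y v j = of_bool (v = j) + of_bool (v = t + 2)" for v
          using that by (auto simp: Y_def sum_unit_vector) (auto simp: unit_vector_def)
        then have "sum Y S j = of_bool (j \<in> S) + of_bool (t + 2 \<in> S)"
          using fin by (simp only: sum_fun_apply sum.distrib sum_of_bool_eq)
        with zero show ?thesis by (auto split: if_splits)
      qed
      have "t + 2 \<notin> S"
      proof
        assume last: "t + 2 \<in> S"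
        have "x \<in> S" if "x \<in> {2..t + 2}" for x
          using that coord[of x] last by (cases "x = t + 2") auto
        then have "{2..t + 2} \<subseteq> S" by blast
        then have "t + 1 \<le> card S" using card_mono[OF fin, of "{2..t + 2}"] by simp
        then show False using S(2) assms(4) by auto
      qed
      then have "Y v = unit_vector 1" if "v \<in> S" for v
        using that coord[of v] S(1) by (cases "v = 1") (auto simp: Y_def)
      then have "sum Y S = (\<Sum>v\<in>S. unit_vector 1)" by (intro sum.cong) auto
      also have "\<dots> = unit_vector 1" using assms(5)[OF S(2)] by (rule sum_const_odd)
      finally have "unit_vector 1 = 0" using zero by simp
      then have "unit_vector 1 1 = 0" by simp
      then show False by (simp add: unit_vector_def)
    qed
  qed
  moreover have "T \<subseteq> {..n}" using assms(3,4) by force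
  ultimately show ?thesis using avoiding_imp_r_odd_le[of T n "t + 1"] by simp
qed

section \<open>Counting zero-sum tuples\<close>

definition sum_tuples :: "('v \<Rightarrow> 'a::elementary_2_group) \<Rightarrow> 'v set \<Rightarrow> nat \<Rightarrow> 'a \<Rightarrow> 'v list set" where
  "sum_tuples Y V m a = {xs. set xs \<subseteq> V \<and> length xs = m \<and> sum_list (map Y xs) = a}"

lemma finite_sum_tuples: "finite V \<Longrightarrow> finite (sum_tuples Y V m a)"
  by (rule finite_subset[OF _ finite_lists_length_eq[of V m]]) (auto simp: sum_tuples_def)

lemma sum_list_in_subgroup: "subgroup2 A \<Longrightarrow> Y ` set xs \<subseteq> A \<Longrightarrow> sum_list (map Y xs) \<in> A"
  by (induction xs) (auto simp: subgroup2_def)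

lemma sum_card_sum_tuples:
  assumes "finite V" "subgroup2 A" "finite A" "Y ` V \<subseteq> A"
  shows "(\<Sum>a\<in>A. card (sum_tuples Y V m a)) = card V ^ m"
proof -
  have "{xs. set xs \<subseteq> V \<and> length xs = m} = (\<Union>a\<in>A. sum_tuples Y V m a)"
    using sum_list_in_subgroup[OF assms(2), of Y] assms(4) by (fastforce simp: sum_tuples_def)
  then have "card {xs. set xs \<subseteq> V \<and> length xs = m} = (\<Sum>a\<in>A. card (sum_tuples Y V m a))"
    by (simp only:) (intro card_UN_disjoint assms ballI impI finite_sum_tuples, auto simp: sum_tuples_def)
  then show ?thesis using card_lists_length_eq[OF assms(1)] by simp
qed

text \<open>Cut a zero-sum tuple after \<open>i\<close> entries; in characteristic two both pieces
  have the same sum \<open>a\<close>.\<close>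

lemma card_sum_tuples_add:
  fixes Y :: "'v \<Rightarrow> 'a::elementary_2_group"
  assumes "finite V" "subgroup2 A" "finite A" "Y ` V \<subseteq> A"
  shows "card (sum_tuples Y V (i + j) 0) = (\<Sum>a\<in>A. card (sum_tuples Y V i a) * card (sum_tuples Y V j a))"
proof -
  let ?P = "\<lambda>a. sum_tuples Y V i a \<times> sum_tuples Y V j a"
  have "sum_tuples Y V (i + j) 0 = (\<Union>a\<in>A. (\<lambda>(xs, ys). xs @ ys) ` ?P a)"
  proof (intro equalityI subsetI)
    fix zs assume zs: "zs \<in> sum_tuples Y V (i + j) 0"
    define a where "a = sum_list (map Y (take i zs))"
    have split: "take i zs @ drop i zs = zs" by simp
    have "set (take i zs) \<subseteq> V" "set (drop i zs) \<subseteq> V"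
      using zs set_take_subset[of i zs] set_drop_subset[of i zs] by (auto simp: sum_tuples_def)
    moreover have "a + sum_list (map Y (drop i zs)) = 0"
      using zs unfolding a_def sum_tuples_def
      by (metis (mono_tags) split map_append mem_Collect_eq sum_list_append)
    then have "sum_list (map Y (drop i zs)) = a" by (simp add: add_eq_0_iff_eq)
    ultimately have "(take i zs, drop i zs) \<in> ?P a"
      using zs by (auto simp: sum_tuples_def a_def)
    moreover have "a \<in> A"
      unfolding a_def using \<open>set (take i zs) \<subseteq> V\<close> assms(4) by (intro sum_list_in_subgroup[OF assms(2)]) auto
    ultimately show "zs \<in> (\<Union>a\<in>A. (\<lambda>(xs, ys). xs @ ys) ` ?P a)"
      using split by (intro UN_I[of a] image_eqI[of _ _ "(take i zs, drop i zs)"]) auto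
  qed (auto simp: sum_tuples_def)
  also have "card \<dots> = (\<Sum>a\<in>A. card ((\<lambda>(xs, ys). xs @ ys) ` ?P a))"
  proof (intro card_UN_disjoint assms ballI impI finite_imageI finite_cartesian_product finite_sum_tuples)
    fix a b :: 'a assume "a \<noteq> b"
    have "xs @ ys \<noteq> xs' @ ys'" if "(xs, ys) \<in> ?P a" "(xs', ys') \<in> ?P b" for xs ys xs' ys'
      using that \<open>a \<noteq> b\<close> by (auto simp: sum_tuples_def append_eq_append_conv)
    then show "(\<lambda>(xs, ys). xs @ ys) ` ?P a \<inter> (\<lambda>(xs, ys). xs @ ys) ` ?P b = {}" by fast
  qed
  also have "\<dots> = (\<Sum>a\<in>A. card (?P a))"
    by (intro sum.cong refl card_image) (auto simp: inj_on_def sum_tuples_def)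
  finally show ?thesis by (simp add: card_cartesian_product)
qed

lemma Cauchy_Schwarz_sum:
  fixes f g :: "'i \<Rightarrow> real"
  shows "(\<Sum>i\<in>I. f i * g i)\<^sup>2 \<le> (\<Sum>i\<in>I. (f i)\<^sup>2) * (\<Sum>i\<in>I. (g i)\<^sup>2)"
proof -
  have "\<bar>\<Sum>i\<in>I. f i * g i\<bar> \<le> (\<Sum>i\<in>I. \<bar>f i\<bar> * \<bar>g i\<bar>)"
    by (rule order_trans[OF sum_abs]) (simp add: abs_mult)
  also have "\<dots> \<le> L2_set f I * L2_set g I" by (rule L2_set_mult_ineq)
  finally have "\<bar>\<Sum>i\<in>I. f i * g i\<bar>\<^sup>2 \<le> (L2_set f I * L2_set g I)\<^sup>2" by (rule power_mono) simp
  then show ?thesis by (simp add: L2_set_def power_mult_distrib sum_nonneg)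
qed

text \<open>If \<open>N m a\<close> counts the \<open>m\<close>-tuples with sum \<open>a\<close>,
  then \<open>E k\<close> and \<open>E (k + 2)\<close> are the sums over \<open>a\<close> of the
  squares of \<open>N k a\<close> and \<open>N (k + 2) a\<close>, while \<open>E (k + 1)\<close> is
  the sum of their products.\<close>

lemma zero_sum_tuples_log_convex:
  assumes "finite V" "subgroup2 A" "finite A" "Y ` V \<subseteq> A"
  defines "E \<equiv> \<lambda>m. real (card (sum_tuples Y V (2 * m) 0))"
  shows "E (k + 1) ^ 2 \<le> E k * E (k + 2)"
proof -
  let ?N = "\<lambda>m a. real (card (sum_tuples Y V m a))"
  have E: "E m = (\<Sum>a\<in>A. (?N m a)\<^sup>2)" for m
    using card_sum_tuples_add[OF assms(1-4), of m m] by (simp add: E_def mult_2 power2_eq_square)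
  have "E (k + 1) = (\<Sum>a\<in>A. ?N k a * ?N (k + 2) a)"
    using card_sum_tuples_add[OF assms(1-4), of k "k + 2"] by (simp add: E_def mult_2)
  then show ?thesis unfolding E[of k] E[of "k + 2"] using Cauchy_Schwarz_sum by metis
qed

text \<open>Without roots this says that the \<open>k\<close>-th root of \<open>E k\<close> is
  increasing. The induction step raises log-convexity to the power \<open>k + 1\<close>, inserts the
  induction hypothesis and cancels \<open>E (k + 1) ^ k\<close>.\<close>

lemma log_convex_power_le:
  fixes E :: "nat \<Rightarrow> real"
  assumes "E 0 = 1" "\<And>k. 0 \<le> E k" "\<And>k. E (k + 1) ^ 2 \<le> E k * E (k + 2)"
  shows "E k ^ (k + 1) \<le> E (k + 1) ^ k"
proof (induction k)
  case 0
  then show ?case using assms(1) by simp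
next
  case (Suc k)
  show ?case
  proof (cases "E (Suc k) = 0")
    case True
    then show ?thesis using assms(2) by simp
  next
    case False
    then have pos: "0 < E (k + 1) ^ k" using assms(2)[of "Suc k"] by simp
    have "E (k + 1) ^ k * E (k + 1) ^ (k + 2) = (E (k + 1) ^ 2) ^ (k + 1)"
      by (simp flip: power_add power_mult add: algebra_simps mult_2_right)
    also have "\<dots> \<le> (E k * E (k + 2)) ^ (k + 1)" by (intro power_mono assms) simp
    also have "\<dots> = E k ^ (k + 1) * E (k + 2) ^ (k + 1)" by (rule power_mult_distrib)
    also have "\<dots> \<le> E (k + 1) ^ k * E (k + 2) ^ (k + 1)"
      by (intro mult_right_mono Suc.IH zero_le_power assms)
    finally have "E (k + 1) ^ (k + 2) \<le> E (k + 2) ^ (k + 1)" using pos by (simp only: mult_le_cancel_left_pos)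
    then show ?thesis by simp
  qed
qed

text \<open>A zero-sum tuple must repeat an entry, and deleting the two equal entries leaves a zero-sum tuple.\<close>

lemma zero_sum_tuples_degenerate:
  assumes "finite V" "d \<ge> 1" and no: "\<And>S. S \<subseteq> V \<Longrightarrow> card S = 2 * d \<Longrightarrow> sum Y S \<noteq> 0"
  shows "card (sum_tuples Y V (2 * d) 0) \<le> (2 * d)\<^sup>2 * card V * card (sum_tuples Y V (2 * (d - 1)) 0)"
proof -
  let ?D = "{..<2 * d} \<times> {..<2 * d} \<times> V \<times> sum_tuples Y V (2 * (d - 1)) 0"
  \<comment> \<open>Inserts \<open>v\<close> at position \<open>i\<close> and once more
    \<open>j\<close> entries later; the two positions account for the factor
    \<open>(2 * d)\<^sup>2\<close>.\<close>
  let ?f = "\<lambda>(i, j, v, xs). take i xs @ [v] @ take j (drop i xs) @ [v] @ drop j (drop i xs)"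
  have "sum_tuples Y V (2 * d) 0 \<subseteq> ?f ` ?D"
  proof
    fix xs assume xs: "xs \<in> sum_tuples Y V (2 * d) 0"
    have "\<not> distinct xs"
    proof
      assume "distinct xs"
      then have "card (set xs) = 2 * d" "sum Y (set xs) = 0"
        using xs by (simp_all add: sum_tuples_def distinct_card sum_list_distinct_conv_sum_set)
      with no[of "set xs"] xs show False by (simp add: sum_tuples_def)
    qed
    then obtain as v bs cs where dec: "xs = as @ [v] @ bs @ [v] @ cs"
      using not_distinct_decomp by blast
    let ?p = "(length as, length bs, v, as @ bs @ cs)"
    have "sum_list (map Y (as @ bs @ cs)) = 0"
      using xs by (simp add: sum_tuples_def dec ac_simps)
    then have "?p \<in> ?D" using xs by (auto simp: sum_tuples_def dec)
    moreover have "xs = ?f ?p" by (simp add: dec)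
    ultimately show "xs \<in> ?f ` ?D" by blast
  qed
  moreover have "finite ?D" using assms(1) finite_sum_tuples by blast
  ultimately have "card (sum_tuples Y V (2 * d) 0) \<le> card ?D" by (rule surj_card_le[rotated])
  then show ?thesis by (simp add: card_cartesian_product power2_eq_square mult.assoc)
qed

lemma zero_sum_free_card_bound:
  fixes Y :: "'v \<Rightarrow> 'a::elementary_2_group"
  assumes V: "finite V" "V \<noteq> {}" and A: "subgroup2 A" "finite A" "card A \<le> 2 ^ k" "Y ` V \<subseteq> A"
    and d: "d \<ge> 1" and no: "\<And>S. S \<subseteq> V \<Longrightarrow> card S = 2 * d \<Longrightarrow> sum Y S \<noteq> 0"
  shows "real (card V) ^ d \<le> 2 ^ k * (4 * real d ^ 2) ^ d"
proof -
  let ?n = "real (card V)"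
  define E where "E m = real (card (sum_tuples Y V (2 * m) 0))" for m
  have n: "0 < ?n" using V by (simp add: card_gt_0_iff)
  have "sum_tuples Y V 0 0 = {[]}" by (auto simp: sum_tuples_def)
  then have "E 0 = 1" by (simp add: E_def)
  have convex: "E (m + 1) ^ 2 \<le> E m * E (m + 2)" for m
    unfolding E_def by (rule zero_sum_tuples_log_convex[OF V(1) A(1,2,4)])
  have "E (d - 1) ^ d \<le> E d ^ (d - 1)"
    using log_convex_power_le[OF \<open>E 0 = 1\<close> _ convex, of "d - 1"] d by (simp add: E_def)
  \<comment> \<open>Cauchy-Schwarz over the possible sums of \<open>d\<close>-tuples bounds
    \<open>E d\<close> from below.\<close>
  have "(?n ^ d)\<^sup>2 = (\<Sum>a\<in>A. real (card (sum_tuples Y V d a)) * 1)\<^sup>2"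
    by (simp flip: of_nat_sum of_nat_power add: sum_card_sum_tuples[OF V(1) A(1,2,4)])
  also have "\<dots> \<le> (\<Sum>a\<in>A. (real (card (sum_tuples Y V d a)))\<^sup>2) * (\<Sum>a\<in>A. 1\<^sup>2)"
    by (rule Cauchy_Schwarz_sum)
  also have "(\<Sum>a\<in>A. (real (card (sum_tuples Y V d a)))\<^sup>2) = E d"
    using card_sum_tuples_add[OF V(1) A(1,2,4), of d d] by (simp add: E_def mult_2 power2_eq_square)
  also have "E d * (\<Sum>a\<in>A. 1\<^sup>2) \<le> E d * 2 ^ k"
    using A(3) by (intro mult_left_mono) (simp_all add: E_def flip: of_nat_le_iff)
  finally have lower: "(?n ^ d)\<^sup>2 \<le> E d * 2 ^ k" .
  then have "E d \<noteq> 0" using n by auto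
  then have pos: "0 < E d" by (simp add: E_def)
  have "E d \<le> (4 * real d ^ 2 * ?n) * E (d - 1)"
    using of_nat_mono[OF zero_sum_tuples_degenerate[OF V(1) d no], where 'a = real] unfolding E_def
    by (simp add: power_mult_distrib)
  \<comment> \<open>In the \<open>d\<close>-th power, \<open>E (d - 1) ^ d\<close> may be replaced
    by \<open>E d ^ (d - 1)\<close>; a single factor \<open>E d\<close> survives on the
    left.\<close>
  then have "E d ^ d \<le> ((4 * real d ^ 2 * ?n) * E (d - 1)) ^ d" using pos by (intro power_mono) auto
  also have "\<dots> \<le> (4 * real d ^ 2 * ?n) ^ d * E d ^ (d - 1)"
    unfolding power_mult_distrib[of _ "E (d - 1)"] using \<open>E (d - 1) ^ d \<le> E d ^ (d - 1)\<close>
    by (intro mult_left_mono) auto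
  finally have "E d * E d ^ (d - 1) \<le> (4 * real d ^ 2 * ?n) ^ d * E d ^ (d - 1)"
    using d by (simp flip: power_Suc)
  then have "E d \<le> (4 * real d ^ 2 * ?n) ^ d" using pos by simp
  with lower have "(?n ^ d)\<^sup>2 \<le> (4 * real d ^ 2 * ?n) ^ d * 2 ^ k"
    by (meson mult_right_mono order_trans zero_le_numeral zero_le_power)
  then have "?n ^ d * ?n ^ d \<le> (2 ^ k * (4 * real d ^ 2) ^ d) * ?n ^ d"
    by (simp add: power_mult_distrib power2_eq_square mult_ac)
  then show ?thesis using n by (simp add: mult_le_cancel_right)
qed

section \<open>BCH configurations\<close>

text \<open>Split off a linear factor at a root \<open>x\<close>. The derivative at \<open>x\<close>
  is the value of the quotient there, so \<open>x\<close> is not a root of the quotient.\<close>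

lemma card_poly_roots_eq_degree:
  fixes p :: "'f::alg_closed_field poly"
  assumes "p \<noteq> 0" "\<And>a. poly p a = 0 \<Longrightarrow> poly (pderiv p) a \<noteq> 0"
  shows "card {x. poly p x = 0} = degree p"
  using assms
proof (induction "degree p" arbitrary: p)
  case 0
  then obtain c where "p = [:c:]" by (metis degree_eq_zeroE)
  with 0 show ?case by simp
next
  case (Suc k)
  then obtain x where x: "poly p x = 0" using alg_closed_imp_poly_has_root[of p] by auto
  then obtain q where p: "p = [:- x, 1:] * q" by (auto simp: poly_eq_0_iff_dvd elim: dvdE)
  have "q \<noteq> 0" using Suc.prems(1) p by auto
  have deg: "degree p = Suc (degree q)" unfolding p using \<open>q \<noteq> 0\<close> by (subst degree_mult_eq) auto
  have deriv: "poly (pderiv p) a = poly q a + (a - x) * poly (pderiv q) a" for a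
    unfolding p pderiv_mult by (simp add: pderiv_pCons algebra_simps)
  have "card {x. poly q x = 0} = degree q"
  proof (rule Suc.hyps(1))
    show "k = degree q" using Suc.hyps(2) deg by simp
    show "poly (pderiv q) a \<noteq> 0" if "poly q a = 0" for a
      using Suc.prems(2)[of a] that deriv[of a] by (auto simp: p)
  qed (rule \<open>q \<noteq> 0\<close>)
  moreover have "poly q x \<noteq> 0" using Suc.prems(2)[OF x] deriv[of x] by simp
  moreover have "{y. poly p y = 0} = insert x {y. poly q y = 0}" by (auto simp: p)
  ultimately show ?case using poly_roots_finite[OF \<open>q \<noteq> 0\<close>] deg by simp
qed

section \<open>Arithmetic and finite fields in characteristic two\<close>

instance alg_closure :: ("{field, elementary_2_group}") elementary_2_group
proof
  fix x :: "'a alg_closure"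
  have "to_ac (1 + 1 :: 'a) = to_ac 0" by (simp only: add_self)
  then have "(1 + 1 :: 'a alg_closure) = 0" by (simp only: to_ac_add to_ac_1 to_ac_0)
  then have "(1 + 1) * x = 0" by (simp only: mult_zero_left)
  then show "x + x = 0" by (simp only: distrib_right mult_1)
qed

lemma square_add:
  fixes x y :: "'f::{comm_ring_1, elementary_2_group}"
  shows "(x + y)\<^sup>2 = x\<^sup>2 + y\<^sup>2"
proof -
  have "(x + y)\<^sup>2 = x\<^sup>2 + y\<^sup>2 + (x * y + x * y)" by (simp only: power2_eq_square algebra_simps)
  then show ?thesis by (simp only: add_self add_0_right)
qed

lemma frobenius_add:
  fixes x y :: "'f::{comm_ring_1, elementary_2_group}"
  shows "(x + y) ^ (2 ^ m) = x ^ (2 ^ m) + y ^ (2 ^ m)"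
  by (induction m) (simp_all add: power_mult square_add mult.commute[of 2])

lemma square_sum:
  fixes f :: "'i \<Rightarrow> 'f::{comm_ring_1, elementary_2_group}"
  shows "(\<Sum>x\<in>S. f x)\<^sup>2 = (\<Sum>x\<in>S. (f x)\<^sup>2)"
  by (induction S rule: infinite_finite_induct) (simp_all add: square_add)

text \<open>The minimum distance of BCH codes: squaring turns odd power sums into the even ones, and a
  polynomial of degree less than \<open>2 * d\<close> vanishing at all but one point of \<open>S\<close> gives a contradiction.\<close>

lemma odd_power_sums_nonzero:
  fixes S :: "'f::{field, elementary_2_group} set"
  assumes S: "finite S" "S \<noteq> {}" "even (card S)" "card S \<le> 2 * d"
    and zero: "\<And>j. j < d \<Longrightarrow> (\<Sum>x\<in>S. x ^ (2 * j + 1)) = 0"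
  shows False
proof -
  have power_sum: "(\<Sum>x\<in>S. x ^ j) = 0" if "j < 2 * d" for j
    using that
  proof (induction j rule: less_induct)
    case (less j)
    show ?case
    proof (cases "even j")
      case True
      then obtain i where i: "j = 2 * i" by blast
      show ?thesis
      proof (cases "i = 0")
        case True
        then show ?thesis using S(3) sum_const_even[of S "1 :: 'f"] i by simp
      next
        case False
        then have "(\<Sum>x\<in>S. x ^ i) = 0" using less i by simp
        then have "(\<Sum>x\<in>S. (x ^ i)\<^sup>2) = 0" unfolding square_sum[symmetric] by simp
        then show ?thesis by (simp add: i power_mult mult.commute[of 2])
      qed
    next
      case False
      then obtain i where "j = 2 * i + 1" by (auto elim: oddE)
      with zero[of i] less.prems show ?thesis by simp
    qed
  qed
  obtain a where a: "a \<in> S" using S(2) by blast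
  define g where "g = (\<Prod>y\<in>S - {a}. [:- y, 1:])"
  have "degree g = card (S - {a})"
    unfolding g_def by (subst degree_prod_eq_sum_degree) auto
  also have "\<dots> < 2 * d" using S a by (metis card_Diff1_less order_less_le_trans)
  finally have deg: "degree g < 2 * d" .
  have "(\<Sum>x\<in>S. poly g x) = (\<Sum>x\<in>S. \<Sum>i\<le>degree g. coeff g i * x ^ i)" by (simp add: poly_altdef)
  also have "\<dots> = (\<Sum>i\<le>degree g. coeff g i * (\<Sum>x\<in>S. x ^ i))"
    by (subst sum.swap) (simp add: sum_distrib_left)
  also have "\<dots> = 0" using deg by (intro sum.neutral) (simp add: power_sum)
  finally have "(\<Sum>x\<in>S. poly g x) = 0" .
  moreover have "(\<Sum>x\<in>S - {a}. poly g x) = 0"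
    using S(1) by (intro sum.neutral) (auto simp: g_def poly_prod)
  ultimately have "poly g a = 0" using S(1) a by (simp add: sum.remove)
  moreover have "poly g a \<noteq> 0" using S(1) by (auto simp: g_def poly_prod)
  ultimately show False by contradiction
qed

text \<open>The fixed points of the \<open>m\<close>-fold Frobenius map, that is, the roots of
  \<open>x ^ (2 ^ m) + x\<close>. The derivative of this polynomial is constant 1, so all its roots
  are simple.\<close>

lemma binary_field_exists:
  assumes "m \<ge> 1"
  obtains F :: "bit alg_closure set" where "finite F" "card F = 2 ^ m" "subgroup2 F"
    "\<And>x j. x \<in> F \<Longrightarrow> x ^ j \<in> F"
proof -
  let ?q = "2 ^ m :: nat"
  let ?p = "monom 1 ?q + [:0, 1:] :: bit alg_closure poly"
  let ?F = "{x :: bit alg_closure. x ^ ?q = x}"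
  have q: "?q > 1" using assms by (intro one_less_power) auto
  have deg: "degree ?p = ?q" using q by (subst degree_add_eq_left) (simp_all add: degree_monom_eq)
  then have p0: "?p \<noteq> 0" using q by (metis degree_0 not_one_less_zero)
  have roots: "{x. poly ?p x = 0} = ?F" by (auto simp: poly_monom add_eq_0_iff_eq)
  have "(of_nat ?q :: bit alg_closure) = 0"
  proof -
    have "(2 :: bit alg_closure) = 0" using add_self[of "1 :: bit alg_closure"] unfolding one_add_one .
    then show ?thesis using assms by (simp add: power_0_left)
  qed
  then have "poly (pderiv ?p) a = 1" for a by (simp add: pderiv_add pderiv_monom pderiv_pCons poly_monom)
  then have card: "card ?F = ?q" using card_poly_roots_eq_degree[OF p0] deg roots by simp
  have sub: "subgroup2 ?F" using q by (auto simp: subgroup2_def frobenius_add)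
  have pow: "x ^ j \<in> ?F" if "x \<in> ?F" for x j
    using that by (simp flip: power_mult add: mult.commute[of j]) (simp add: power_mult)
  have "finite ?F" using poly_roots_finite[OF p0] unfolding roots .
  then show ?thesis using card sub pow by (rule that)
qed

text \<open>The coordinates below \<open>d\<close> are the odd powers of a field element (\<open>m\<close> bits each) and the coordinate
  \<open>d\<close> is constant 1, which excludes sets of odd size. The vertices up to \<open>t + 1\<close> are used only to make
  the total sum zero: a zero-sum set meeting them contains all of them, so it is larger than \<open>t\<close>.\<close>

lemma bch_vectors:
  assumes T: "\<And>s. s \<in> T \<Longrightarrow> 1 \<le> s \<and> s \<le> t \<and> (even s \<longrightarrow> s \<le> 2 * d)"
    and n: "t + 1 \<le> n" "n \<le> 2 ^ m" and m: "m \<ge> 1"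
  shows "\<exists>A (Y :: nat \<Rightarrow> nat \<Rightarrow> bit alg_closure). avoiding n T (m * d + t + 1) A Y"
proof -
  obtain F :: "bit alg_closure set" where F: "finite F" "card F = 2 ^ m" "subgroup2 F"
    "\<And>x j. x \<in> F \<Longrightarrow> x ^ j \<in> F"
    using binary_field_exists[OF m] by blast
  let ?V = "{1..n}"
  obtain \<alpha> where \<alpha>: "\<alpha> ` ?V \<subseteq> F" "inj_on \<alpha> ?V"
    using card_le_inj[of ?V F] F n by auto
  \<comment> \<open>Coordinates \<open>d + 1\<close> to \<open>d + t\<close> are reserved for the
    vertices 1 to \<open>t\<close>, one each.\<close>
  define Z :: "nat \<Rightarrow> nat \<Rightarrow> bit alg_closure" where
    "Z v = (\<lambda>j. if v \<le> t then of_bool (j = d + v)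
       else if j < d then \<alpha> v ^ (2 * j + 1) else of_bool (j = d))" for v
  define Y where "Y v = (if v = t + 1 then \<Sum>u\<in>?V - {t + 1}. Z u else Z v)" for v
  \<comment> \<open>There are \<open>m\<close> bits for each of the first \<open>d\<close>
    coordinates and one bit for each of the coordinates \<open>d\<close> to \<open>d + t\<close>,
    hence the exponent \<open>m * d + t + 1\<close>.\<close>
  define A where "A = {f :: nat \<Rightarrow> bit alg_closure.
    (\<forall>j<d. f j \<in> F) \<and> (\<forall>j. d \<le> j \<longrightarrow> f j \<in> {0, 1}) \<and> (\<forall>j. d + t < j \<longrightarrow> f j = 0)}"
  have F0: "0 \<in> F" using F(3) by (simp add: subgroup2_def)
  have A: "subgroup2 A"
    unfolding subgroup2_def
  proof (intro conjI ballI)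
    show "0 \<in> A" using F0 by (simp add: A_def)
    fix f g assume fg: "f \<in> A" "g \<in> A"
    have "f j + g j \<in> F" if "j < d" for j
      using fg that by (intro subgroup2_add[OF F(3)]) (simp_all add: A_def)
    moreover have "f j + g j \<in> {0, 1}" if "d \<le> j" for j
    proof -
      have "f j \<in> {0, 1}" "g j \<in> {0, 1}" using fg that unfolding A_def by blast+
      then show ?thesis by auto
    qed
    moreover have "f j + g j = 0" if "d + t < j" for j using fg that by (simp add: A_def)
    ultimately show "f + g \<in> A" unfolding A_def mem_Collect_eq plus_fun_apply by blast
  qed
  have ZA: "Z v \<in> A" if "v \<in> ?V" for v
  proof (cases "v \<le> t")
    case True
    then show ?thesis using F0 by (simp add: A_def Z_def)
  next
    case False
    have "\<alpha> v ^ (2 * j + 1) \<in> F" for j using that \<alpha>(1) by (intro F(4)) auto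
    with False show ?thesis by (simp add: A_def Z_def)
  qed
  let ?D = "\<lambda>j. if j < d then F else {0, 1}"
  let ?ext = "\<lambda>f j. if j \<le> d + t then f j else 0"
  have subA: "A \<subseteq> ?ext ` PiE {..d + t} ?D"
  proof
    fix f assume "f \<in> A"
    then have "restrict f {..d + t} \<in> PiE {..d + t} ?D" "f = ?ext (restrict f {..d + t})"
      by (auto simp: A_def fun_eq_iff)
    then show "f \<in> ?ext ` PiE {..d + t} ?D" by blast
  qed
  have finPi: "finite (PiE {..d + t} ?D)" using F(1) by (intro finite_PiE) auto
  then have finA: "finite A" using subA by (rule finite_surj)
  from finPi subA have "card A \<le> card (PiE {..d + t} ?D)" by (rule surj_card_le)
  also have "card (PiE {..d + t} ?D) = (\<Prod>j\<in>{..d + t}. card (?D j))" by (rule card_PiE) simp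
  also have "{..d + t} = {..<d} \<union> {d..d + t}" by auto
  also have "(\<Prod>j\<in>{..<d} \<union> {d..d + t}. card (?D j)) = (\<Prod>j\<in>{..<d}. card (?D j)) * (\<Prod>j\<in>{d..d + t}. card (?D j))"
    by (intro prod.union_disjoint) auto
  also have "(\<Prod>j\<in>{..<d}. card (?D j)) = (2 ^ m) ^ d" by (simp add: F(2))
  also have "(\<Prod>j\<in>{d..d + t}. card (?D j)) = 2 ^ (t + 1)" by (simp add: numeral_2_eq_2)
  also have "(2 ^ m) ^ d * 2 ^ (t + 1) = (2 :: nat) ^ (m * d + t + 1)"
    by (simp add: power_mult power_add)
  finally have cardA: "card A \<le> 2 ^ (m * d + t + 1)" .
  have "avoiding n T (m * d + t + 1) A Y"
    unfolding avoiding_def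
  proof (intro conjI allI impI)
    show "Y ` ?V \<subseteq> A"
      using ZA subgroup2_sum[OF A, of "?V - {t + 1}" Z] by (auto simp: Y_def)
    have "sum Y ?V = Y (t + 1) + sum Y (?V - {t + 1})" using n(1) by (intro sum.remove) auto
    also have "sum Y (?V - {t + 1}) = sum Z (?V - {t + 1})" by (intro sum.cong) (auto simp: Y_def)
    also have "Y (t + 1) = sum Z (?V - {t + 1})" unfolding Y_def by (rule if_P) simp
    finally show "sum Y ?V = 0" by (simp only: add_self)
    fix S assume S: "S \<subseteq> ?V" "card S \<in> T"
    show "sum Y S \<noteq> 0"
    proof
      assume "sum Y S = 0"
      then have coord: "(\<Sum>v\<in>S. Y v j) = 0" for j by (metis sum_fun_apply zero_fun_apply)
      have finS: "finite S" using S(1) finite_subset by blast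
      \<comment> \<open>In coordinate \<open>d + i\<close> only the vertices \<open>i\<close> and
        \<open>t + 1\<close> are nonzero, both with value 1.\<close>
      have special: "i \<in> S \<longleftrightarrow> t + 1 \<in> S" if i: "i \<in> {1..t}" for i
      proof -
        have Zi: "Z u (d + i) = of_bool (u = i)" if "u \<in> ?V - {t + 1}" for u
          using i by (auto simp: Z_def)
        have "Y (t + 1) (d + i) = (\<Sum>u\<in>?V - {t + 1}. of_bool (u = i))"
          unfolding Y_def by (simp only: if_True refl sum_fun_apply) (rule sum.cong[OF refl], rule Zi)
        also have "\<dots> = 1" using i n(1) by (simp add: of_bool_def sum.delta)
        finally have "Y v (d + i) = of_bool (v = i) + of_bool (v = t + 1)" if "v \<in> ?V" for v
          using i that Zi[of v] by (cases "v = t + 1") (auto simp: Y_def)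
        then have "(\<Sum>v\<in>S. Y v (d + i)) = (\<Sum>v\<in>S. of_bool (v = i) + of_bool (v = t + 1))"
          using S(1) by (intro sum.cong) auto
        also have "\<dots> = of_bool (i \<in> S) + of_bool (t + 1 \<in> S)"
          using finS by (simp add: sum.distrib of_bool_def sum.delta)
        finally have "of_bool (i \<in> S) + of_bool (t + 1 \<in> S) = (0 :: bit alg_closure)"
          unfolding coord by (rule sym)
        then show ?thesis by (simp only: add_eq_0_iff_eq of_bool_eq_iff)
      qed
      have "t + 1 \<notin> S"
      proof
        assume last: "t + 1 \<in> S"
        have "x \<in> S" if "x \<in> {1..t + 1}" for x
          using that special[of x] last by (cases "x = t + 1") auto
        then have "{1..t + 1} \<subseteq> S" by blast
        then have "t + 1 \<le> card S" using card_mono[OF finS, of "{1..t + 1}"] by simp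
        then show False using T[OF S(2)] by simp
      qed
      then have normal: "t + 1 < v" if "v \<in> S" for v
        using that special[of v] S(1) by (cases "v \<le> t"; cases "v = t + 1") auto
      have YS: "Y v j = (if j < d then \<alpha> v ^ (2 * j + 1) else of_bool (j = d))" if "v \<in> S" for v j
        using normal[OF that] by (simp add: Y_def Z_def)
      have "(\<Sum>v\<in>S. 1 :: bit alg_closure) = 0" using coord[of d] by (simp add: YS)
      then have "even (card S)" using sum_const_odd[of S "1 :: bit alg_closure"] by (metis one_neq_zero)
      have inj: "inj_on \<alpha> S" using \<alpha>(2) S(1) by (rule inj_on_subset)
      have "(\<Sum>x\<in>\<alpha> ` S. x ^ (2 * j + 1)) = 0" if "j < d" for j
        using coord[of j] that by (simp add: sum.reindex[OF inj] YS)
      moreover have "card (\<alpha> ` S) = card S" using inj by (rule card_image)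
      moreover have "S \<noteq> {}" using T[OF S(2)] by auto
      ultimately show False
        using odd_power_sums_nonzero[of "\<alpha> ` S" d] \<open>even (card S)\<close> T[OF S(2)] finS by auto
    qed
  qed (use A finA cardA in auto)
  then show ?thesis by blast
qed

section \<open>The odd-Ramsey numbers\<close>

lemma admissibleD:
  assumes "admissible n T"
  shows "finite T" "T \<noteq> {}" "\<And>s. s \<in> T \<Longrightarrow> 1 \<le> s" "\<And>s. s \<in> T \<Longrightarrow> 2 * s \<le> n"
    "\<And>s. s \<in> T \<Longrightarrow> odd s \<Longrightarrow> odd n"
proof -
  show "finite T" using assms finite_subset by (auto simp: admissible_def)
  show "T \<noteq> {}" using assms by (simp add: admissible_def)
  show "1 \<le> s" if "s \<in> T" for s using assms that by (auto simp: admissible_def)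
  show le: "2 * s \<le> n" if "s \<in> T" for s using assms that by (force simp: admissible_def)
  show "odd n" if "s \<in> T" "odd s" for s
  proof -
    have "even (s * (n - s))" using assms that(1) unfolding admissible_def by blast
    with that(2) le[OF that(1)] show ?thesis by simp
  qed
qed

lemma r_odd_all_odd:
  assumes T: "admissible n T" and odd: "\<forall>s\<in>T. odd s"
  shows "r_odd n (bipartite_family n T) = Max T + 2"
proof -
  let ?t = "Max T"
  have t: "?t \<in> T" using admissibleD[OF T] by (intro Max_in)
  have "odd n" using admissibleD(5)[OF T t] odd t by blast
  moreover have "2 * ?t \<le> n" "1 \<le> ?t" using admissibleD(3,4)[OF T] t by blast+
  \<comment> \<open>Parity of \<open>n\<close> gains the 1 that allows \<open>k = ?t\<close> in
    \<open>r_odd_ge\<close>.\<close>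
  ultimately have n: "2 * ?t + 1 \<le> n" by (metis Suc_eq_plus1 Suc_leI dvd_triv_left le_neq_implies_less)
  have "T \<subseteq> {..?t}" using admissibleD(1)[OF T] by auto
  then have "r_odd n (bipartite_family n T) \<le> ?t + 2"
    using odd t n \<open>odd n\<close> \<open>1 \<le> ?t\<close> by (intro r_odd_le_odd) auto
  moreover have "?t + 2 \<le> r_odd n (bipartite_family n T)"
    using n \<open>odd n\<close> by (intro r_odd_ge[OF T t]) auto
  ultimately show ?thesis by simp
qed

lemma r_odd_log_lower:
  assumes T: "admissible n T" and d: "2 * d \<in> T"
  shows "real d * log 2 (real n) - real d * log 2 (4 * real d ^ 2) \<le> real (r_odd n (bipartite_family n T))"
proof -
  let ?r = "r_odd n (bipartite_family n T)"
  have "1 \<le> d" "1 \<le> n" using admissibleD(3,4)[OF T d] by linarith+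
  obtain A and Y :: "nat \<Rightarrow> nat \<Rightarrow> bit" where Y: "avoiding n T (?r - 1) A Y"
    using r_odd_avoiding[OF T] by blast
  have "real (card {1..n}) ^ d \<le> 2 ^ (?r - 1) * (4 * real d ^ 2) ^ d"
  proof (rule zero_sum_free_card_bound)
    show "subgroup2 A" "finite A" "card A \<le> 2 ^ (?r - 1)" "Y ` {1..n} \<subseteq> A"
      using Y by (simp_all add: avoiding_def)
    show "sum Y S \<noteq> 0" if "S \<subseteq> {1..n}" "card S = 2 * d" for S
      using Y d that unfolding avoiding_def by metis
  qed (use \<open>1 \<le> d\<close> \<open>1 \<le> n\<close> in auto)
  then have "log 2 (real n ^ d) \<le> log 2 (2 ^ (?r - 1) * (4 * real d ^ 2) ^ d)"
    using \<open>1 \<le> d\<close> \<open>1 \<le> n\<close> by (subst log_le_cancel_iff) simp_all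
  also have "\<dots> = real (?r - 1) + real d * log 2 (4 * real d ^ 2)"
  proof -
    have "log 2 ((4 * real d ^ 2) ^ d) = real d * log 2 (4 * real d ^ 2)"
      using \<open>1 \<le> d\<close> by (intro log_nat_power) simp
    moreover have "log 2 (2 ^ (?r - 1)) = real (?r - 1)" by (subst log_nat_power) simp_all
    moreover have "log 2 (2 ^ (?r - 1) * (4 * real d ^ 2) ^ d) =
        log 2 (2 ^ (?r - 1)) + log 2 ((4 * real d ^ 2) ^ d)"
      using \<open>1 \<le> d\<close> by (simp add: log_mult)
    ultimately show ?thesis by simp
  qed
  finally show ?thesis using \<open>1 \<le> n\<close> by (simp add: log_nat_power)
qed

text \<open>BCH vectors need field elements of \<open>?m\<close> bits. Rounding the logarithm up
  costs at most one bit for each of \<open>d\<close> coordinates, hence the summand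
  \<open>d\<close>; the remaining coordinates and the extra colour give
  \<open>Max T + 2\<close>.\<close>

lemma r_odd_log_upper:
  assumes T: "admissible n T" and d: "2 * d \<in> T" "\<And>s. s \<in> T \<Longrightarrow> even s \<Longrightarrow> s \<le> 2 * d"
  shows "real (r_odd n (bipartite_family n T)) \<le> real d * log 2 (real n) + real d + real (Max T) + 2"
proof -
  let ?m = "nat \<lceil>log 2 (real n)\<rceil>" and ?t = "Max T"
  have t: "?t \<in> T" using admissibleD[OF T] by (intro Max_in)
  have n: "2 * ?t \<le> n" "1 \<le> ?t" using admissibleD(3,4)[OF T t] by blast+
  then have log: "1 \<le> log 2 (real n)" by (subst le_log_iff) simp_all
  then have m: "log 2 (real n) \<le> real ?m" "real ?m \<le> log 2 (real n) + 1" "1 \<le> ?m"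
    by (linarith+)
  have "real n = 2 powr log 2 (real n)" using n by simp
  also have "\<dots> \<le> 2 powr real ?m" using m(1) by simp
  also have "\<dots> = real (2 ^ ?m)" by (simp add: powr_realpow)
  finally have nm: "n \<le> 2 ^ ?m" by (simp only: of_nat_le_iff)
  have bound: "1 \<le> s \<and> s \<le> ?t \<and> (even s \<longrightarrow> s \<le> 2 * d)" if "s \<in> T" for s
    using that admissibleD(1,3)[OF T] d(2) by simp
  have "?t + 1 \<le> n" using n by linarith
  from bch_vectors[OF bound this nm m(3)]
  obtain A and Y :: "nat \<Rightarrow> nat \<Rightarrow> bit alg_closure" where "avoiding n T (?m * d + ?t + 1) A Y"
    by blast
  moreover have "T \<subseteq> {..n}" using admissibleD(4)[OF T] by fastforce
  ultimately have "r_odd n (bipartite_family n T) \<le> ?m * d + ?t + 1 + 1"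
    by (intro avoiding_imp_r_odd_le)
  then have "real (r_odd n (bipartite_family n T)) \<le> real (?m * d + ?t + 1 + 1)" by (rule of_nat_mono)
  also have "\<dots> = real ?m * real d + real ?t + 2" by simp
  also have "real ?m * real d \<le> (log 2 (real n) + 1) * real d" using m(2) by (rule mult_right_mono) simp
  finally show ?thesis by (simp add: algebra_simps)
qed

theorem corollary1p4:
  shows
    "(\<forall>n T. admissible n T \<and> (\<forall>s\<in>T. odd s) \<longrightarrow>
        r_odd n (bipartite_family n T) = Max T + 2) \<and>
     (\<forall>d::nat. \<exists>C::real. \<forall>n T.
        admissible n T \<and> (\<exists>s\<in>T. even s) \<and> Max {s \<in> T. even s} = 2 * d \<longrightarrow>
          real d * log 2 (real n) - C \<le> real (r_odd n (bipartite_family n T)) \<and>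
          real (r_odd n (bipartite_family n T))
            \<le> real d * log 2 (real n) + real d + real (Max T) + 2) \<and>
     (\<forall>n d T. admissible n T \<and> T = {2 * d} \<longrightarrow>
        (n = 4 * d \<longrightarrow> r_odd n (bipartite_family n T) = 2 * d + 1) \<and>
        (n > 4 * d \<longrightarrow>
          2 * d + 2 \<le> r_odd n (bipartite_family n T) \<and>
          r_odd n (bipartite_family n T) \<le> n - 2 * d + 1))"
proof (intro conjI allI impI exI)
  fix n T assume "admissible n T \<and> (\<forall>s\<in>T. odd s)"
  then show "r_odd n (bipartite_family n T) = Max T + 2" by (simp add: r_odd_all_odd)
next
  fix d n T assume T: "admissible n T \<and> (\<exists>s\<in>T. even s) \<and> Max {s \<in> T. even s} = 2 * d"
  then have fin: "finite {s \<in> T. even s}" using admissibleD(1)[of n T] by simp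
  then have "2 * d \<in> {s \<in> T. even s}" using T Max_in[OF fin] by auto
  then have d: "2 * d \<in> T" by simp
  have "s \<le> 2 * d" if "s \<in> T" "even s" for s
    using T Max_ge[OF fin, of s] that by simp
  \<comment> \<open>The constant left open by \<open>exI\<close> becomes
    \<open>real d * log 2 (4 * real d ^ 2)\<close>, which depends on \<open>d\<close> alone.\<close>
  with T d show
    "real d * log 2 (real n) - real d * log 2 (4 * real d ^ 2) \<le> real (r_odd n (bipartite_family n T))"
    "real (r_odd n (bipartite_family n T)) \<le> real d * log 2 (real n) + real d + real (Max T) + 2"
    using r_odd_log_lower r_odd_log_upper by blast+
next
  fix n d T assume "admissible n T \<and> T = {2 * d}"
  then have T: "admissible n T" "2 * d \<in> T" and T_eq: "T = {2 * d}" by auto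
  have d: "1 \<le> d" "4 * d \<le> n" using admissibleD(3,4)[OF T] by linarith+
  \<comment> \<open>The simplex bound with \<open>q = n - 2 * d + 1\<close>, so that
    \<open>n - q = 2 * d - 1\<close> is just below the forbidden size.\<close>
  have upper: "r_odd n (bipartite_family n T) \<le> n - 2 * d + 1"
    using d by (intro r_odd_le_simplex) (auto simp: T_eq)
  \<comment> \<open>The condition \<open>2 * k + 1 \<le> n\<close> of \<open>r_odd_ge\<close> allows
    \<open>k = 2 * d - 1\<close> here, and \<open>k = 2 * d\<close> as soon as
    \<open>n > 4 * d\<close>.\<close>
  show "r_odd n (bipartite_family n T) = 2 * d + 1" if "n = 4 * d"
    using r_odd_ge[OF T, of "2 * d - 1"] d upper that by simp
  show "2 * d + 2 \<le> r_odd n (bipartite_family n T)" if "n > 4 * d"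
    using r_odd_ge[OF T, of "2 * d"] that by simp
  show "r_odd n (bipartite_family n T) \<le> n - 2 * d + 1" by (rule upper)
qed

end
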